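(* Let $p$ and $q$ be distinct primes with $pq\neq 6$, $q\neq 2$ and $q\mid p-1$. Let $r$ be an integer with $r^{q}\equiv 1 \pmod{p}$ and $r\not\equiv 1\pmod{p}$, and let $G=\langle a,b,c\mid a^{q^{2}}=b^{p}=c^{p}=[b,c]=1,\ a^{-1}ba=b^{r},\ a^{-1}ca=c^{r^{-1}}\rangle$, where $r^{-1}$ is an inverse of $r$ modulo $p$. Then $\mathrm{Aut}(G)\simeq(\mathbb{Z}_{p}\times\mathbb{Z}_{p})\rtimes(((\mathbb{Z}_{p-1}\times\mathbb{Z}_{p-1})\times\mathbb{Z}_{q})\rtimes\mathbb{Z}_{2})$.
   Context: $\mathbb{Z}_n$ is the cyclic group of order $n$; $[x,y]=x^{-1}y^{-1}xy$. $X\rtimes Y$ denotes a semidirect product with normal subgroup $X$ with respect to some homomorphism $Y\to\mathrm{Aut}(X)$; the statement asserts that $\mathrm{Aut}(G)$ is isomorphic to such an (iterated) semidirect product for some choice of actions. *)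

theory Defs
  imports
    "HOL-Algebra.Coset"
    "HOL-Algebra.Bij"
    "HOL-Algebra.Elementary_Groups"
    "HOL-Number_Theory.Cong"
    "HOL-Computational_Algebra.Primes"
begin

section \<open>Free groups\<close>

text \<open>
  The letter \<open>(x, True)\<close> of a word stands for the generator \<open>x\<close>, the letter \<open>(x, False)\<close> for its
  formal inverse. The generators are all the elements of the type \<open>'g\<close>.
\<close>

inductive word_eq :: "('g \<times> bool) list \<Rightarrow> ('g \<times> bool) list \<Rightarrow> bool" where
  cancel: "word_eq (u @ [(x, e), (x, \<not> e)] @ v) (u @ v)"
| refl: "word_eq u u"
| sym: "word_eq u v \<Longrightarrow> word_eq v u"
| trans: "word_eq u v \<Longrightarrow> word_eq v w \<Longrightarrow> word_eq u w"

definition word_class :: "('g \<times> bool) list \<Rightarrow> ('g \<times> bool) list set" where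
  "word_class u = {v. word_eq u v}"

definition free_group :: "('g \<times> bool) list set monoid" where
  "free_group =
    \<lparr>carrier = range word_class,
     monoid.mult = \<lambda>A B. \<Union>u\<in>A. \<Union>v\<in>B. word_class (u @ v),
     one = word_class []\<rparr>"

definition free_gen :: "'g \<Rightarrow> ('g \<times> bool) list set" where
  "free_gen x = word_class [(x, True)]"

lemma word_class_eq_iff: "word_class u = word_class v \<longleftrightarrow> word_eq u v"
proof
  assume "word_class u = word_class v"
  then show "word_eq u v"
    using word_eq.refl[of v] by (auto simp: word_class_def)
next
  assume uv: "word_eq u v"
  have "word_eq u w \<longleftrightarrow> word_eq v w" for w
    using word_eq.trans[OF uv] word_eq.trans[OF word_eq.sym[OF uv]] by (rule iffI[rotated])
  then show "word_class u = word_class v"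
    by (simp add: word_class_def)
qed

lemma word_eq_append_left: "word_eq u v \<Longrightarrow> word_eq (w @ u) (w @ v)"
proof (induction rule: word_eq.induct)
  case (cancel u x e v)
  then show ?case using word_eq.cancel[of "w @ u" x e v] by simp
next
  case (refl u)
  show ?case by (rule word_eq.refl)
next
  case (sym u v)
  from sym.IH show ?case by (rule word_eq.sym)
next
  case (trans u v v')
  from trans.IH show ?case by (rule word_eq.trans)
qed

lemma word_eq_append_right: "word_eq u v \<Longrightarrow> word_eq (u @ w) (v @ w)"
proof (induction rule: word_eq.induct)
  case (cancel u x e v)
  then show ?case using word_eq.cancel[of u x e "v @ w"] by simp
next
  case (refl u)
  show ?case by (rule word_eq.refl)
next
  case (sym u v)
  from sym.IH show ?case by (rule word_eq.sym)
next
  case (trans u v v')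
  from trans.IH show ?case by (rule word_eq.trans)
qed

lemma word_eq_append: "word_eq u u' \<Longrightarrow> word_eq v v' \<Longrightarrow> word_eq (u @ v) (u' @ v')"
  by (meson word_eq.trans word_eq_append_left word_eq_append_right)

lemma carrier_free_group: "carrier free_group = range word_class"
  by (simp add: free_group_def)

lemma one_free_group: "\<one>\<^bsub>free_group\<^esub> = word_class []"
  by (simp add: free_group_def)

lemma mult_free_group:
  "word_class u \<otimes>\<^bsub>free_group\<^esub> word_class v = word_class (u @ v)"
proof -
  have "word_class (u' @ v') = word_class (u @ v)"
    if "u' \<in> word_class u" "v' \<in> word_class v" for u' v'
  proof -
    have "word_eq (u @ v) (u' @ v')"
      using that by (intro word_eq_append) (simp_all add: word_class_def)
    then show ?thesis
      unfolding word_class_eq_iff by (rule word_eq.sym)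
  qed
  moreover have "u \<in> word_class u" "v \<in> word_class v"
    by (simp_all add: word_class_def word_eq.refl)
  ultimately have "(\<Union>u'\<in>word_class u. \<Union>v'\<in>word_class v. word_class (u' @ v')) = word_class (u @ v)"
    by blast
  then show ?thesis
    by (simp add: free_group_def)
qed

lemma word_eq_inverse: "word_eq (map (\<lambda>(x, e). (x, \<not> e)) (rev u) @ u) []"
proof (induction u)
  case Nil
  show ?case by (simp add: word_eq.refl)
next
  case (Cons a u)
  obtain x e where a: "a = (x, e)" by force
  have "word_eq (map (\<lambda>(x, e). (x, \<not> e)) (rev u) @ [(x, \<not> e), (x, \<not> \<not> e)] @ u)
                (map (\<lambda>(x, e). (x, \<not> e)) (rev u) @ u)"
    by (rule word_eq.cancel)
  from word_eq.trans[OF this Cons.IH] show ?case by (simp add: a)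
qed

lemma group_free_group: "group free_group"
proof (rule groupI)
  fix A :: "('g \<times> bool) list set"
  assume "A \<in> carrier free_group"
  then obtain u where u: "A = word_class u" by (auto simp: carrier_free_group)
  show "\<exists>B \<in> carrier free_group. B \<otimes>\<^bsub>free_group\<^esub> A = \<one>\<^bsub>free_group\<^esub>"
    using word_eq_inverse[of u]
    by (auto simp: u carrier_free_group one_free_group mult_free_group word_class_eq_iff)
qed (auto simp: carrier_free_group one_free_group mult_free_group)

section \<open>Groups given by generators and relators\<close>

definition normal_closure :: "('a, 'b) monoid_scheme \<Rightarrow> 'a set \<Rightarrow> 'a set" where
  "normal_closure G R = \<Inter> {N. N \<lhd> G \<and> R \<subseteq> N}"

lemma (in group) carrier_normal: "carrier G \<lhd> G"
  by (simp add: normal_inv_iff subgroup_self)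

lemma (in group) normal_closure_normal:
  assumes "R \<subseteq> carrier G"
  shows "normal_closure G R \<lhd> G"
proof -
  have *: "{N. N \<lhd> G \<and> R \<subseteq> N} \<noteq> {}"
    using assms carrier_normal by blast
  have "subgroup (normal_closure G R) G"
    unfolding normal_closure_def
    by (rule subgroups_Inter) (use * in \<open>auto dest: normal_imp_subgroup\<close>)
  then show ?thesis
    unfolding normal_inv_iff by (auto simp: normal_closure_def intro: normal.inv_op_closed2)
qed

definition presented_group ::
  "('g \<times> bool) list set set \<Rightarrow> ('g \<times> bool) list set set monoid" where
  "presented_group R = free_group Mod normal_closure free_group R"

lemma group_presented_group:
  "R \<subseteq> carrier free_group \<Longrightarrow> group (presented_group R)"
  unfolding presented_group_def
  by (intro normal.factorgroup_is_group group.normal_closure_normal group_free_group)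

section \<open>The group \<open>G\<close>\<close>

datatype gen = GenA | GenB | GenC

text \<open>
  An equation \<open>u = v\<close> between words is encoded by the relator \<open>u v\<^sup>-\<^sup>1\<close>. The parameter \<open>s\<close> is
  meant to be an inverse of \<open>r\<close> modulo \<open>p\<close>.
\<close>

definition relators_G :: "nat \<Rightarrow> nat \<Rightarrow> int \<Rightarrow> int \<Rightarrow> (gen \<times> bool) list set set" where
  "relators_G p q r s =
    (let F = free_group; a = free_gen GenA; b = free_gen GenB; c = free_gen GenC in
     {a [^]\<^bsub>F\<^esub> (q ^ 2),
      b [^]\<^bsub>F\<^esub> p,
      c [^]\<^bsub>F\<^esub> p,
      inv\<^bsub>F\<^esub> b \<otimes>\<^bsub>F\<^esub> inv\<^bsub>F\<^esub> c \<otimes>\<^bsub>F\<^esub> b \<otimes>\<^bsub>F\<^esub> c,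
      (inv\<^bsub>F\<^esub> a \<otimes>\<^bsub>F\<^esub> b \<otimes>\<^bsub>F\<^esub> a) \<otimes>\<^bsub>F\<^esub> inv\<^bsub>F\<^esub> (b [^]\<^bsub>F\<^esub> r),
      (inv\<^bsub>F\<^esub> a \<otimes>\<^bsub>F\<^esub> c \<otimes>\<^bsub>F\<^esub> a) \<otimes>\<^bsub>F\<^esub> inv\<^bsub>F\<^esub> (c [^]\<^bsub>F\<^esub> s)})"

definition group_G :: "nat \<Rightarrow> nat \<Rightarrow> int \<Rightarrow> int \<Rightarrow> (gen \<times> bool) list set set monoid" where
  "group_G p q r s = presented_group (relators_G p q r s)"

lemma relators_G_subset: "relators_G p q r s \<subseteq> carrier free_group"
proof -
  interpret group "free_group :: (gen \<times> bool) list set monoid" by (rule group_free_group)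
  have "free_gen x \<in> carrier free_group" for x :: gen
    by (simp add: free_gen_def carrier_free_group)
  then show ?thesis by (simp add: relators_G_def Let_def)
qed

lemma group_group_G: "group (group_G p q r s)"
  unfolding group_G_def by (rule group_presented_group[OF relators_G_subset])

section \<open>Semidirect products\<close>

text \<open>The normal factor is \<open>N\<close>; the action \<open>\<phi>\<close> is meant to be a homomorphism \<open>H \<rightarrow> Aut(N)\<close>.\<close>

definition semidirect_product ::
  "('a, 'c) monoid_scheme \<Rightarrow> ('b, 'd) monoid_scheme \<Rightarrow> ('b \<Rightarrow> 'a \<Rightarrow> 'a) \<Rightarrow> ('a \<times> 'b) monoid" where
  "semidirect_product N H \<phi> =
    \<lparr>carrier = carrier N \<times> carrier H,
     monoid.mult = \<lambda>(n, h) (n', h'). (n \<otimes>\<^bsub>N\<^esub> \<phi> h n', h \<otimes>\<^bsub>H\<^esub> h'),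
     one = (\<one>\<^bsub>N\<^esub>, \<one>\<^bsub>H\<^esub>)\<rparr>"

lemma group_semidirect_product:
  assumes "group N" "group H" and \<phi>: "\<phi> \<in> hom H (AutoGroup N)"
  shows "group (semidirect_product N H \<phi>)"
proof -
  interpret N: group N by fact
  interpret H: group H by fact
  interpret A: group "AutoGroup N" by (rule N.AutoGroup)
  interpret \<phi>: group_hom H "AutoGroup N" \<phi>
    using \<phi> by unfold_locales
  have auto: "\<phi> h \<in> auto N" if "h \<in> carrier H" for h
    using \<phi>.hom_closed[OF that] by (simp add: AutoGroup_def)
  have closed: "\<phi> h n \<in> carrier N" if "h \<in> carrier H" "n \<in> carrier N" for h n
    using auto[OF that(1)] that(2) by (auto simp: auto_def hom_def)
  have mult: "\<phi> h (n \<otimes>\<^bsub>N\<^esub> n') = \<phi> h n \<otimes>\<^bsub>N\<^esub> \<phi> h n'"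
    if "h \<in> carrier H" "n \<in> carrier N" "n' \<in> carrier N" for h n n'
    using auto[OF that(1)] that(2,3) by (auto simp: auto_def hom_def)
  have comp: "\<phi> (h \<otimes>\<^bsub>H\<^esub> h') n = \<phi> h (\<phi> h' n)"
    if "h \<in> carrier H" "h' \<in> carrier H" "n \<in> carrier N" for h h' n
    using auto[OF that(1)] auto[OF that(2)] that
    by (simp add: AutoGroup_def BijGroup_def auto_def compose_def)
  have one: "\<phi> \<one>\<^bsub>H\<^esub> n = n" if "n \<in> carrier N" for n
    using \<phi>.hom_one that by (simp add: AutoGroup_def BijGroup_def)
  show ?thesis
  proof (rule groupI)
    fix x assume "x \<in> carrier (semidirect_product N H \<phi>)"
    then obtain n h where x: "x = (n, h)" "n \<in> carrier N" "h \<in> carrier H"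
      by (auto simp: semidirect_product_def)
    let ?y = "(\<phi> (inv\<^bsub>H\<^esub> h) (inv\<^bsub>N\<^esub> n), inv\<^bsub>H\<^esub> h)"
    have "\<phi> (inv\<^bsub>H\<^esub> h) (inv\<^bsub>N\<^esub> n) \<otimes>\<^bsub>N\<^esub> \<phi> (inv\<^bsub>H\<^esub> h) n = \<phi> (inv\<^bsub>H\<^esub> h) \<one>\<^bsub>N\<^esub>"
      using x mult[of "inv\<^bsub>H\<^esub> h" "inv\<^bsub>N\<^esub> n" n] by (simp del: \<phi>.hom_inv)
    also have "\<dots> = \<one>\<^bsub>N\<^esub>"
      using mult[of "inv\<^bsub>H\<^esub> h" "\<one>\<^bsub>N\<^esub>" "\<one>\<^bsub>N\<^esub>"] closed[of "inv\<^bsub>H\<^esub> h" "\<one>\<^bsub>N\<^esub>"] x by (simp del: \<phi>.hom_inv)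
    finally have "?y \<otimes>\<^bsub>semidirect_product N H \<phi>\<^esub> x = \<one>\<^bsub>semidirect_product N H \<phi>\<^esub>"
      using x by (simp add: semidirect_product_def del: \<phi>.hom_inv)
    moreover have "?y \<in> carrier (semidirect_product N H \<phi>)"
      using x by (simp add: semidirect_product_def closed del: \<phi>.hom_inv)
    ultimately show "\<exists>y \<in> carrier (semidirect_product N H \<phi>).
        y \<otimes>\<^bsub>semidirect_product N H \<phi>\<^esub> x = \<one>\<^bsub>semidirect_product N H \<phi>\<^esub>"
      by blast
  qed (auto simp: semidirect_product_def closed mult comp one N.m_assoc H.m_assoc
           simp del: \<phi>.hom_mult \<phi>.hom_one)
qed

end

theory Submission
  imports Defs "HOL-Number_Theory.Residue_Primitive_Roots"
begin

text \<open>
  Every element of \<open>G\<close> is uniquely \<open>b\<^sup>x c\<^sup>y a\<^sup>i\<close> with \<open>x\<close>, \<open>y\<close> modulo \<open>p\<close> and \<open>i\<close> modulo \<open>q\<^sup>2\<close>, and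
  conjugation by \<open>a\<close> acts on the plane \<open>P = \<langle>b, c\<rangle>\<close> with the eigenvalues \<open>s\<close> and \<open>s\<^sup>-\<^sup>1\<close>, which have
  order \<open>q\<close> and are different because \<open>q\<close> is odd. An automorphism preserves \<open>P\<close>, the set of
  elements killed by \<open>p\<close>, and sends \<open>a\<close> into some coset \<open>P a\<^sup>i\<close>; comparing the eigenvalues of
  \<open>a\<close> and \<open>a\<^sup>i\<close> forces \<open>i\<close> to be \<open>1\<close> or \<open>-1\<close> modulo \<open>q\<close>. In the first case the two eigenlines
  \<open>\<langle>b\<rangle>\<close> and \<open>\<langle>c\<rangle>\<close> are fixed, in the second they are exchanged.

  Since \<open>1 - s\<^sup>i\<close> is then invertible modulo \<open>p\<close>, all elements of \<open>P a\<^sup>i\<close> are conjugate to \<open>a\<^sup>i\<close> under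
  \<open>P\<close>. Hence, after composition with a unique inner automorphism by an element of \<open>P\<close>, an
  automorphism stabilises \<open>\<langle>a\<rangle>\<close>, and the stabiliser consists of the maps
  \<open>b \<mapsto> b\<^sup>U, c \<mapsto> c\<^sup>V, a \<mapsto> a\<^sup>j\<close> with \<open>j \<equiv> 1\<close> modulo \<open>q\<close> and of their products with the involution
  \<open>b \<leftrightarrow> c, a \<mapsto> a\<^sup>-\<^sup>1\<close> (lemmas \<open>aut_decomposition\<close> and \<open>aut_decomposition_unique\<close>). The inner part is
  \<open>P \<cong> \<int>\<^sub>p \<times> \<int>\<^sub>p\<close>; the pairs \<open>(U, V)\<close> form \<open>\<int>\<^sub>p\<^sub>-\<^sub>1 \<times> \<int>\<^sub>p\<^sub>-\<^sub>1\<close> through a primitive root modulo \<open>p\<close>, and the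
  exponents \<open>j = 1 + q k\<close> modulo \<open>q\<^sup>2\<close> form \<open>\<int>\<^sub>q\<close>. The two semidirect decompositions both come out of
  the lemma \<open>semidirect_hom\<close>, which reconstructs the action from normalisation inside the ambient group.

  The rest is the normal form itself. The presented group is rewritten into it by the relations,
  and a group of triples satisfying the relations shows that no two normal forms coincide
  (lemma \<open>presented_group_coordinates\<close>).
\<close>

section \<open>Semidirect products inside a group\<close>

lemma auto_group_carrier:
  "f \<in> carrier (AutoGroup N) \<longleftrightarrow>
    f \<in> hom N N \<and> bij_betw f (carrier N) (carrier N) \<and> f \<in> extensional (carrier N)"
  by (auto simp: AutoGroup_def auto_def Bij_def)

lemma auto_group_mult:
  assumes "f \<in> carrier (AutoGroup N)" "g \<in> carrier (AutoGroup N)"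
  shows "f \<otimes>\<^bsub>AutoGroup N\<^esub> g = compose (carrier N) f g"
  using assms by (auto simp: AutoGroup_def BijGroup_def auto_def)

text \<open>
  An internal product \<open>\<alpha>(N) \<beta>(H)\<close> in which \<open>\<beta>(H)\<close> normalises \<open>\<alpha>(N)\<close> is an image of an external
  semidirect product. Injectivity of \<open>\<alpha>\<close> is what turns conjugation by \<open>\<beta> h\<close> into a well-defined
  map on \<open>N\<close>. The homomorphism \<open>\<beta>\<close> may have a kernel, so that bijectivity of the product map is a
  separate question.
\<close>
lemma semidirect_hom:
  fixes A :: "('a, 'x) monoid_scheme" and N :: "('n, 'y) monoid_scheme" and H :: "('h, 'z) monoid_scheme"
  assumes "group A" "group N" "group H"
    and \<alpha>: "\<alpha> \<in> hom N A" and inj: "inj_on \<alpha> (carrier N)" and \<beta>: "\<beta> \<in> hom H A"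
    and norm: "\<And>h n. h \<in> carrier H \<Longrightarrow> n \<in> carrier N \<Longrightarrow>
      \<exists>n'\<in>carrier N. \<beta> h \<otimes>\<^bsub>A\<^esub> \<alpha> n = \<alpha> n' \<otimes>\<^bsub>A\<^esub> \<beta> h"
  obtains \<phi> where "\<phi> \<in> hom H (AutoGroup N)"
    and "(\<lambda>(n, h). \<alpha> n \<otimes>\<^bsub>A\<^esub> \<beta> h) \<in> hom (semidirect_product N H \<phi>) A"
proof -
  interpret A: group A by fact
  interpret N: group N by fact
  interpret H: group H by fact
  interpret \<alpha>: group_hom N A \<alpha> using \<alpha> by unfold_locales
  interpret \<beta>: group_hom H A \<beta> using \<beta> by unfold_locales
  define \<phi> where "\<phi> h = (\<lambda>n\<in>carrier N. SOME n'. n' \<in> carrier N \<and> \<beta> h \<otimes>\<^bsub>A\<^esub> \<alpha> n = \<alpha> n' \<otimes>\<^bsub>A\<^esub> \<beta> h)" for h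
  have *: "\<phi> h n \<in> carrier N \<and> \<beta> h \<otimes>\<^bsub>A\<^esub> \<alpha> n = \<alpha> (\<phi> h n) \<otimes>\<^bsub>A\<^esub> \<beta> h"
    if "h \<in> carrier H" "n \<in> carrier N" for h n
  proof -
    have "\<exists>n'. n' \<in> carrier N \<and> \<beta> h \<otimes>\<^bsub>A\<^esub> \<alpha> n = \<alpha> n' \<otimes>\<^bsub>A\<^esub> \<beta> h"
      using norm[OF that] by blast
    from someI_ex[OF this] show ?thesis using that by (simp add: \<phi>_def)
  qed
  have closed: "\<phi> h n \<in> carrier N" and eq: "\<beta> h \<otimes>\<^bsub>A\<^esub> \<alpha> n = \<alpha> (\<phi> h n) \<otimes>\<^bsub>A\<^esub> \<beta> h"
    if "h \<in> carrier H" "n \<in> carrier N" for h n using *[OF that] by auto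
  have uniq: "\<phi> h n = n'"
    if "h \<in> carrier H" "n \<in> carrier N" "n' \<in> carrier N" "\<beta> h \<otimes>\<^bsub>A\<^esub> \<alpha> n = \<alpha> n' \<otimes>\<^bsub>A\<^esub> \<beta> h" for h n n'
  proof -
    have "\<alpha> (\<phi> h n) \<otimes>\<^bsub>A\<^esub> \<beta> h = \<alpha> n' \<otimes>\<^bsub>A\<^esub> \<beta> h" using eq[OF that(1,2)] that(4) by simp
    then have "\<alpha> (\<phi> h n) = \<alpha> n'" using that closed by simp
    then show ?thesis using inj that closed by (auto dest: inj_onD)
  qed
  have mult: "\<phi> h (n \<otimes>\<^bsub>N\<^esub> n') = \<phi> h n \<otimes>\<^bsub>N\<^esub> \<phi> h n'"
    if h: "h \<in> carrier H" and n: "n \<in> carrier N" and n': "n' \<in> carrier N" for h n n'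
  proof (rule uniq)
    have "\<beta> h \<otimes>\<^bsub>A\<^esub> \<alpha> (n \<otimes>\<^bsub>N\<^esub> n') = (\<beta> h \<otimes>\<^bsub>A\<^esub> \<alpha> n) \<otimes>\<^bsub>A\<^esub> \<alpha> n'"
      using that by (simp add: A.m_assoc)
    also have "\<dots> = \<alpha> (\<phi> h n) \<otimes>\<^bsub>A\<^esub> (\<beta> h \<otimes>\<^bsub>A\<^esub> \<alpha> n')"
      using that closed by (simp add: eq A.m_assoc)
    also have "\<dots> = \<alpha> (\<phi> h n \<otimes>\<^bsub>N\<^esub> \<phi> h n') \<otimes>\<^bsub>A\<^esub> \<beta> h"
      using that closed by (simp add: eq[OF h n'] A.m_assoc)
    finally show "\<beta> h \<otimes>\<^bsub>A\<^esub> \<alpha> (n \<otimes>\<^bsub>N\<^esub> n') = \<alpha> (\<phi> h n \<otimes>\<^bsub>N\<^esub> \<phi> h n') \<otimes>\<^bsub>A\<^esub> \<beta> h" .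
  qed (use that closed in auto)
  have comp: "\<phi> (h \<otimes>\<^bsub>H\<^esub> h') n = \<phi> h (\<phi> h' n)"
    if h: "h \<in> carrier H" and h': "h' \<in> carrier H" and n: "n \<in> carrier N" for h h' n
  proof (rule uniq)
    have "\<beta> (h \<otimes>\<^bsub>H\<^esub> h') \<otimes>\<^bsub>A\<^esub> \<alpha> n = \<beta> h \<otimes>\<^bsub>A\<^esub> (\<beta> h' \<otimes>\<^bsub>A\<^esub> \<alpha> n)"
      using that by (simp add: A.m_assoc)
    also have "\<dots> = (\<beta> h \<otimes>\<^bsub>A\<^esub> \<alpha> (\<phi> h' n)) \<otimes>\<^bsub>A\<^esub> \<beta> h'"
      using that closed by (simp add: eq[OF h' n] A.m_assoc)
    also have "\<dots> = \<alpha> (\<phi> h (\<phi> h' n)) \<otimes>\<^bsub>A\<^esub> \<beta> (h \<otimes>\<^bsub>H\<^esub> h')"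
      using that closed by (simp add: eq[OF h] A.m_assoc)
    finally show "\<beta> (h \<otimes>\<^bsub>H\<^esub> h') \<otimes>\<^bsub>A\<^esub> \<alpha> n = \<alpha> (\<phi> h (\<phi> h' n)) \<otimes>\<^bsub>A\<^esub> \<beta> (h \<otimes>\<^bsub>H\<^esub> h')" .
  qed (use that closed in auto)
  have one: "\<phi> \<one>\<^bsub>H\<^esub> n = n" if "n \<in> carrier N" for n
    by (rule uniq) (use that in auto)
  have bij: "bij_betw (\<phi> h) (carrier N) (carrier N)" if h: "h \<in> carrier H" for h
    by (rule bij_betw_byWitness[where f' = "\<phi> (inv\<^bsub>H\<^esub> h)"])
      (use h closed comp[of "inv\<^bsub>H\<^esub> h" h, symmetric] comp[of h "inv\<^bsub>H\<^esub> h", symmetric] one in auto)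
  have aut: "\<phi> h \<in> carrier (AutoGroup N)" if "h \<in> carrier H" for h
    unfolding auto_group_carrier using that closed mult bij by (auto simp: hom_def \<phi>_def)
  have 1: "\<phi> \<in> hom H (AutoGroup N)"
  proof (rule homI)
    fix h h' assume h: "h \<in> carrier H" "h' \<in> carrier H"
    have "\<phi> (h \<otimes>\<^bsub>H\<^esub> h') = compose (carrier N) (\<phi> h) (\<phi> h')"
    proof (rule extensionalityI[where A = "carrier N"])
      show "\<phi> (h \<otimes>\<^bsub>H\<^esub> h') \<in> extensional (carrier N)" by (simp add: \<phi>_def)
    qed (use comp h in \<open>auto simp: compose_def\<close>)
    then show "\<phi> (h \<otimes>\<^bsub>H\<^esub> h') = \<phi> h \<otimes>\<^bsub>AutoGroup N\<^esub> \<phi> h'"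
      using h aut by (simp add: auto_group_mult)
  qed (rule aut)
  have 2: "(\<lambda>(n, h). \<alpha> n \<otimes>\<^bsub>A\<^esub> \<beta> h) \<in> hom (semidirect_product N H \<phi>) A"
  proof (rule homI)
    fix x y assume "x \<in> carrier (semidirect_product N H \<phi>)" "y \<in> carrier (semidirect_product N H \<phi>)"
    then obtain n h n' h' where x: "x = (n, h)" "n \<in> carrier N" "h \<in> carrier H"
      and y: "y = (n', h')" "n' \<in> carrier N" "h' \<in> carrier H"
      by (auto simp: semidirect_product_def)
    have "\<alpha> (n \<otimes>\<^bsub>N\<^esub> \<phi> h n') \<otimes>\<^bsub>A\<^esub> \<beta> (h \<otimes>\<^bsub>H\<^esub> h') = \<alpha> n \<otimes>\<^bsub>A\<^esub> (\<alpha> (\<phi> h n') \<otimes>\<^bsub>A\<^esub> \<beta> h) \<otimes>\<^bsub>A\<^esub> \<beta> h'"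
      using x y closed by (simp add: A.m_assoc)
    also have "\<dots> = (\<alpha> n \<otimes>\<^bsub>A\<^esub> \<beta> h) \<otimes>\<^bsub>A\<^esub> (\<alpha> n' \<otimes>\<^bsub>A\<^esub> \<beta> h')"
      using x y closed by (simp add: A.m_assoc flip: eq)
    finally show "(case x \<otimes>\<^bsub>semidirect_product N H \<phi>\<^esub> y of (n, h) \<Rightarrow> \<alpha> n \<otimes>\<^bsub>A\<^esub> \<beta> h) =
        (case x of (n, h) \<Rightarrow> \<alpha> n \<otimes>\<^bsub>A\<^esub> \<beta> h) \<otimes>\<^bsub>A\<^esub> (case y of (n, h) \<Rightarrow> \<alpha> n \<otimes>\<^bsub>A\<^esub> \<beta> h)"
      using x y by (simp add: semidirect_product_def)
  qed (auto simp: semidirect_product_def)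
  show ?thesis using that 1 2 .
qed

section \<open>Exponentials modulo a prime\<close>

lemma not_dvd_of_add_mult:
  fixes f :: "int \<Rightarrow> int"
  assumes p: "prime p" and add: "\<And>i j. [f (i + j) = f i * f j] (mod int p)" and zero: "[f 0 = 1] (mod int p)"
  shows "\<not> int p dvd f i"
proof
  assume "int p dvd f i"
  then have "int p dvd f i * f (- i)" by simp
  moreover have "[f i * f (- i) = 1] (mod int p)"
    using add[of i "- i"] zero by (simp add: cong_def)
  ultimately have "int p dvd 1" by (metis cong_dvd_iff)
  then show False using p not_prime_unit[of "int p"] by simp
qed

text \<open>
  The exponential \<open>u \<mapsto> g\<^sup>u\<close> to the base of a primitive root \<open>g\<close>. Integers rather than naturals
  serve as exponents so that inverses need no case distinctions.
\<close>
lemma discrete_exponential_exists: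
  assumes p: "prime p"
  obtains e :: "int \<Rightarrow> int" where "\<And>u v. [e (u + v) = e u * e v] (mod int p)"
    and "\<And>u v. [e u = e v] (mod int p) \<longleftrightarrow> [u = v] (mod int (p - 1))"
    and "\<And>x. \<not> int p dvd x \<Longrightarrow> \<exists>u. [x = e u] (mod int p)"
    and "e 0 = 1"
proof -
  have p1: "p > 1" using p prime_gt_1_nat by blast
  obtain g where g: "residue_primroot p g" using prime_primitive_root_exists[OF p1 p] by blast
  have cop: "coprime p g" and ord: "ord p g = p - 1"
    using g p by (auto simp: residue_primroot_def totient_prime)
  define e where "e u = int (g ^ nat (u mod int (p - 1)))" for u
  have nn: "int (nat (u mod int (p - 1))) = u mod int (p - 1)" for u
    using p1 by simp
  have eq: "[int (g ^ m) = int (g ^ n)] (mod int p) \<longleftrightarrow> [int m = int n] (mod int (p - 1))" for m n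
    using order_divides_expdiff[OF cop, of m n] ord by (simp only: cong_int_iff)
  have 1: "[e (u + v) = e u * e v] (mod int p)" for u v
  proof -
    have "e u * e v = int (g ^ (nat (u mod int (p - 1)) + nat (v mod int (p - 1))))"
      by (simp add: e_def power_add)
    moreover have "[int (nat ((u + v) mod int (p - 1))) = int (nat (u mod int (p - 1)) + nat (v mod int (p - 1)))] (mod int (p - 1))"
      unfolding of_nat_add nn by (simp add: cong_def mod_simps)
    ultimately show ?thesis unfolding e_def eq[symmetric] by simp
  qed
  have 2: "[e u = e v] (mod int p) \<longleftrightarrow> [u = v] (mod int (p - 1))" for u v
    unfolding e_def eq nn by (simp add: cong_def)
  have 3: "\<exists>u. [x = e u] (mod int p)" if "\<not> int p dvd x" for x
  proof -
    have pos: "x mod int p > 0"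
      using that p1 by (metis dvd_eq_mod_eq_0 less_le of_nat_0_less_iff order.strict_trans pos_mod_sign zero_less_one)
    have "\<not> p dvd nat (x mod int p)"
      using pos p1 by (intro nat_dvd_not_less) (simp_all add: nat_less_iff)
    then have "coprime (nat (x mod int p)) p"
      using p by (simp add: prime_imp_coprime coprime_commute[of _ p])
    moreover have "x mod int p \<le> int p" using p1 by (intro less_imp_le pos_mod_bound) simp
    ultimately have "nat (x mod int p) \<in> totatives p"
      using pos p1 by (auto simp: totatives_def nat_le_iff)
    then obtain i where i: "i < p - 1" "nat (x mod int p) = g ^ i mod p"
      using residue_primroot_is_generator[OF p1 g] p by (auto simp: bij_betw_def totient_prime)
    have "e (int i) = int (g ^ i)" using i by (simp add: e_def)
    moreover have "x mod int p = int (g ^ i) mod int p"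
      using pos arg_cong[OF i(2), of int] by (simp add: zmod_int)
    ultimately have "[x = e (int i)] (mod int p)" by (simp add: cong_def)
    then show ?thesis by blast
  qed
  have 4: "e 0 = 1" by (simp add: e_def)
  show ?thesis by (rule that[OF 1 2 3 4])
qed

text \<open>
  Here \<open>w i\<close> plays the role of \<open>s\<^sup>i\<close> modulo \<open>p\<close> for a unit \<open>s\<close> of order \<open>q\<close>, with integer exponents:
  conjugation by \<open>a\<^sup>i\<close> will raise \<open>b\<close> to the power \<open>w i\<close> and \<open>c\<close> to the power \<open>w (- i)\<close>.
\<close>
locale power_character =
  fixes p q :: nat and w :: "int \<Rightarrow> int"
  assumes p: "prime p" and q: "prime q" and p_neq_q: "p \<noteq> q" and q_odd: "q \<noteq> 2"
    and w_add: "[w (i + j) = w i * w j] (mod int p)"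
    and w_eq_1_iff: "[w i = 1] (mod int p) \<longleftrightarrow> int q dvd i"
begin

abbreviation cong_p :: "int \<Rightarrow> int \<Rightarrow> bool" (infix "\<approx>" 50) where
  "x \<approx> y \<equiv> [x = y] (mod int p)"

lemma prime_p: "prime (int p)" and prime_q: "prime (int q)"
  using p q by simp_all

lemma w_0: "w 0 \<approx> 1"
  by (simp add: w_eq_1_iff)

lemma w_0_mult: "w 0 * z \<approx> z"
  using cong_mult[OF w_0 cong_refl[of z]] by simp

lemma w_unit: "\<not> int p dvd w i"
  using not_dvd_of_add_mult[OF p w_add w_0] .

lemma cancel_unit: "\<not> int p dvd u \<Longrightarrow> u * x \<approx> u * y \<longleftrightarrow> x \<approx> y"
  using prime_imp_coprime[OF prime_p, of u] by (intro cong_mult_lcancel) (simp add: coprime_commute)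

lemma w_cong_iff: "w i \<approx> w j \<longleftrightarrow> [i = j] (mod int q)"
proof -
  have "w i \<approx> w j * w (i - j)" using w_add[of j "i - j"] by simp
  then have "w i \<approx> w j \<longleftrightarrow> w j * w (i - j) \<approx> w j * 1" by (simp add: cong_def)
  also have "\<dots> \<longleftrightarrow> int q dvd i - j" using cancel_unit[OF w_unit] w_eq_1_iff by blast
  finally show ?thesis by (simp add: cong_iff_dvd_diff)
qed

lemma cong_q2_q: "[i = j] (mod int q ^ 2) \<Longrightarrow> [i = j] (mod int q)"
  by (rule cong_dvd_modulus) (auto simp: power2_eq_square)

lemma w_cong: "[i = j] (mod int q ^ 2) \<Longrightarrow> w i \<approx> w j"
  using cong_q2_q w_cong_iff by blast

end

section \<open>Automorphisms in coordinates\<close>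

text \<open>A one-parameter subgroup is determined by its value at 1.\<close>
lemma (in group) int_pow_eq_of_add_mult:
  fixes f :: "int \<Rightarrow> 'a"
  assumes "\<And>x. f x \<in> carrier G" and "\<And>x y. f (x + y) = f x \<otimes> f y"
  shows "f 1 [^] x = f x"
proof -
  have "f \<in> hom integer_group G" using assms by (intro homI) simp_all
  then have "f (1 [^]\<^bsub>integer_group\<^esub> x) = f 1 [^] x"
    by (intro hom_int_pow) (simp_all add: group_axioms)
  then show ?thesis by simp
qed

text \<open>
  The element \<open>el x y i\<close> is \<open>b\<^sup>x c\<^sup>y a\<^sup>i\<close>. The coordinates are arbitrary integers, and equality in
  \<open>G\<close> is congruence of coordinates, so that computations with automorphisms stay polynomial identities
  between integers instead of identities between reduced residues.
\<close>
locale coordinate_group = group G + power_character p q w for G (structure) and p q w +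
  fixes el :: "int \<Rightarrow> int \<Rightarrow> int \<Rightarrow> 'a"
  assumes carrier_eq: "carrier G = {el x y i | x y i. True}"
    and el_eq_iff: "el x y i = el x' y' i' \<longleftrightarrow>
      [x = x'] (mod int p) \<and> [y = y'] (mod int p) \<and> [i = i'] (mod int q ^ 2)"
    and el_mult: "el x y i \<otimes> el x' y' i' = el (x + w i * x') (y + w (- i) * y') (i + i')"
begin

lemma el_closed [simp]: "el x y i \<in> carrier G"
  by (auto simp: carrier_eq)

lemma el_cases:
  assumes "g \<in> carrier G" obtains x y i where "g = el x y i"
  using assms by (auto simp: carrier_eq)

lemma one_eq: "\<one> = el 0 0 0"
proof -
  have "el 0 0 0 \<otimes> el 0 0 0 = el 0 0 0" by (simp add: el_mult)
  then show ?thesis by (metis el_closed r_cancel_one)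
qed

lemma finite_carrier: "finite (carrier G)"
proof (rule finite_subset)
  let ?B = "{0..<int p} \<times> {0..<int p} \<times> {0..<int q ^ 2}"
  show "carrier G \<subseteq> (\<lambda>(x, y, i). el x y i) ` ?B"
  proof
    fix g assume "g \<in> carrier G"
    then obtain x y i where g: "g = el x y i" by (rule el_cases)
    have "g = (case (x mod int p, y mod int p, i mod int q ^ 2) of (x, y, i) \<Rightarrow> el x y i)"
      unfolding g by (simp add: el_eq_iff cong_def)
    moreover have "(x mod int p, y mod int p, i mod int q ^ 2) \<in> ?B"
      using p q by (auto simp: prime_gt_0_nat)
    ultimately show "g \<in> (\<lambda>(x, y, i). el x y i) ` ?B"
      by (rule image_eqI)
  qed
qed auto

text \<open>Coordinates are not unique, so that the description has a meaning only if \<open>T\<close> respects congruences.\<close>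
definition coord_map :: "(int \<Rightarrow> int \<Rightarrow> int \<Rightarrow> 'a) \<Rightarrow> 'a \<Rightarrow> 'a" where
  "coord_map T = (\<lambda>g\<in>carrier G. THE h. \<exists>x y i. g = el x y i \<and> h = T x y i)"

text \<open>
  The equivalence in the second assumption contains both well-definedness and injectivity;
  surjectivity is then free because \<open>G\<close> is finite.
\<close>
lemma coord_map_aut:
  assumes closed: "\<And>x y i. T x y i \<in> carrier G"
    and eq_iff: "\<And>x y i x' y' i'. T x y i = T x' y' i' \<longleftrightarrow> el x y i = el x' y' i'"
    and mult: "\<And>x y i x' y' i'.
      T (x + w i * x') (y + w (- i) * y') (i + i') = T x y i \<otimes> T x' y' i'"
  shows "coord_map T \<in> carrier (AutoGroup G)" and "coord_map T (el x y i) = T x y i"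
proof -
  have ap: "coord_map T (el x y i) = T x y i" for x y i
    unfolding coord_map_def by (simp, rule the_equality) (use eq_iff in auto)
  then show "coord_map T (el x y i) = T x y i" .
  have hom: "coord_map T \<in> hom G G"
  proof (rule homI)
    fix g assume "g \<in> carrier G"
    then obtain x y i where g: "g = el x y i" by (rule el_cases)
    show "coord_map T g \<in> carrier G" using closed by (simp add: g ap)
    fix h assume "h \<in> carrier G"
    then obtain x' y' i' where h: "h = el x' y' i'" by (rule el_cases)
    show "coord_map T (g \<otimes> h) = coord_map T g \<otimes> coord_map T h"
      by (simp add: g h ap el_mult mult)
  qed
  have inj: "inj_on (coord_map T) (carrier G)"
    by (rule inj_onI) (auto simp: carrier_eq ap eq_iff)
  have "coord_map T ` carrier G \<subseteq> carrier G"
    using hom by (auto simp: hom_def)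
  then have "bij_betw (coord_map T) (carrier G) (carrier G)"
    using endo_inj_surj[OF finite_carrier _ inj] inj by (simp add: bij_betw_def)
  then show "coord_map T \<in> carrier (AutoGroup G)"
    using hom by (simp add: auto_group_carrier coord_map_def)
qed

text \<open>
  The formula is that of conjugation by \<open>b\<^sup>m c\<^sup>n\<close>: the two factors around \<open>el x y i\<close> contribute \<open>m\<close>
  and \<open>- w i * m\<close> to the first coordinate.
\<close>
definition conj_by :: "int \<Rightarrow> int \<Rightarrow> 'a \<Rightarrow> 'a" where
  "conj_by m n = coord_map (\<lambda>x y i. el (x + (1 - w i) * m) (y + (1 - w (- i)) * n) i)"

definition diag :: "int \<Rightarrow> int \<Rightarrow> int \<Rightarrow> 'a \<Rightarrow> 'a" where
  "diag U V j = coord_map (\<lambda>x y i. el (U * x) (V * y) (j * i))"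

definition swap :: "'a \<Rightarrow> 'a" where
  "swap = coord_map (\<lambda>x y i. el y x (- i))"

lemma el_cong:
  "x \<approx> x' \<Longrightarrow> y \<approx> y' \<Longrightarrow> [i = i'] (mod int q ^ 2) \<Longrightarrow> el x y i = el x' y' i'"
  by (simp add: el_eq_iff)

lemma conj_aut: "conj_by m n \<in> carrier (AutoGroup G)"
  and conj_el: "conj_by m n (el x y i) = el (x + (1 - w i) * m) (y + (1 - w (- i)) * n) i"
proof -
  let ?T = "\<lambda>x y i. el (x + (1 - w i) * m) (y + (1 - w (- i)) * n) i"
  have 1: "?T x y i = ?T x' y' i' \<longleftrightarrow> el x y i = el x' y' i'" for x y i x' y' i'
  proof -
    have "x + (1 - w i) * m \<approx> x' + (1 - w i') * m \<longleftrightarrow> x \<approx> x'"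
      "y + (1 - w (- i)) * n \<approx> y' + (1 - w (- i')) * n \<longleftrightarrow> y \<approx> y'"
      if i: "[i = i'] (mod int q ^ 2)"
    proof -
      have *: "x + (1 - w i) * m \<approx> x' + (1 - w i') * m \<longleftrightarrow> x \<approx> x'"
        if "w i \<approx> w i'" for x x' m i i'
      proof -
        have "(1 - w i) * m \<approx> (1 - w i') * m"
          using that by (intro cong_mult cong_diff cong_refl)
        then have "x' + (1 - w i') * m \<approx> x' + (1 - w i) * m"
          by (intro cong_add cong_refl) (rule cong_sym)
        then have "x + (1 - w i) * m \<approx> x' + (1 - w i') * m \<longleftrightarrow>
            x + (1 - w i) * m \<approx> x' + (1 - w i) * m"
          by (simp add: cong_def)
        then show ?thesis by (simp add: cong_add_rcancel)
      qed
      show "x + (1 - w i) * m \<approx> x' + (1 - w i') * m \<longleftrightarrow> x \<approx> x'"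
        by (rule *[OF w_cong[OF i]])
      have "[- i = - i'] (mod int q ^ 2)" using i by (simp add: cong_minus_minus_iff)
      then show "y + (1 - w (- i)) * n \<approx> y' + (1 - w (- i')) * n \<longleftrightarrow> y \<approx> y'"
        using * w_cong by blast
    qed
    then show ?thesis unfolding el_eq_iff by blast
  qed
  have aux: "x + u * x' + (1 - w (a + b)) * m \<approx> x + (1 - w a) * m + w a * (x' + (1 - w b) * m)"
    if "u = w a" for x u x' a b m
  proof -
    have "x + u * x' + (1 - w (a + b)) * m \<approx> x + u * x' + (1 - w a * w b) * m"
      by (intro cong_add cong_mult cong_diff cong_refl w_add)
    then show ?thesis by (simp add: that algebra_simps)
  qed
  have 2: "?T (x + w i * x') (y + w (- i) * y') (i + i') = ?T x y i \<otimes> ?T x' y' i'" for x y i x' y' i'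
    unfolding el_mult using aux[of _ "i" x x' i' m] aux[of _ "-i" y y' "-i'" n]
    by (intro el_cong) auto
  show "conj_by m n \<in> carrier (AutoGroup G)"
    "conj_by m n (el x y i) = el (x + (1 - w i) * m) (y + (1 - w (- i)) * n) i"
    unfolding conj_by_def by (rule coord_map_aut; use 1 2 in simp)+
qed

text \<open>
  Replacing \<open>i\<close> by \<open>j * i\<close> does not disturb the action of \<open>a\<^sup>i\<close> on \<open>b\<close> and \<open>c\<close>, since that action
  depends only on \<open>i\<close> modulo \<open>q\<close>.
\<close>
lemma diag_aut:
  assumes U: "\<not> int p dvd U" and V: "\<not> int p dvd V" and j: "[j = 1] (mod int q)"
  shows "diag U V j \<in> carrier (AutoGroup G)" and "diag U V j (el x y i) = el (U * x) (V * y) (j * i)"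
proof -
  let ?T = "\<lambda>x y i. el (U * x) (V * y) (j * i)"
  have "coprime j (int q)"
    using cong_imp_coprime[OF cong_sym[OF j]] by simp
  then have "coprime j (int q ^ 2)" by simp
  then have 1: "?T x y i = ?T x' y' i' \<longleftrightarrow> el x y i = el x' y' i'" for x y i x' y' i'
    by (simp add: el_eq_iff cancel_unit U V cong_mult_lcancel)
  have w: "w i \<approx> w (j * i)" for i
    unfolding w_cong_iff using cong_mult[OF j cong_refl[of i]] by (simp add: cong_sym)
  have aux: "U * (x + w i * x') \<approx> U * x + w (j * i) * (U * x')" for U x x' i
  proof -
    have "U * (x + w i * x') \<approx> U * (x + w (j * i) * x')"
      by (intro cong_add cong_mult cong_refl w)
    then show ?thesis by (simp add: algebra_simps)
  qed
  have 2: "?T (x + w i * x') (y + w (- i) * y') (i + i') = ?T x y i \<otimes> ?T x' y' i'" for x y i x' y' i'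
    unfolding el_mult using aux[of U x i x'] aux[of V y "-i" y']
    by (intro el_cong) (auto simp: algebra_simps)
  show "diag U V j \<in> carrier (AutoGroup G)" "diag U V j (el x y i) = el (U * x) (V * y) (j * i)"
    unfolding diag_def by (rule coord_map_aut; use 1 2 in simp)+
qed

lemma swap_aut: "swap \<in> carrier (AutoGroup G)"
  and swap_el: "swap (el x y i) = el y x (- i)"
  unfolding swap_def by (rule coord_map_aut; auto simp: el_eq_iff el_mult cong_minus_minus_iff)+

lemma aut_mult_apply:
  assumes "f \<in> carrier (AutoGroup G)" "g \<in> carrier (AutoGroup G)"
  shows "(f \<otimes>\<^bsub>AutoGroup G\<^esub> g) (el x y i) = f (g (el x y i))"
  using assms by (simp add: auto_group_mult compose_def)

lemma aut_eqI:
  assumes "f \<in> carrier (AutoGroup G)" "g \<in> carrier (AutoGroup G)"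
    and "\<And>x y i. f (el x y i) = g (el x y i)"
  shows "f = g"
  using assms by (intro extensionalityI[of _ "carrier G"]) (auto simp: auto_group_carrier carrier_eq)

lemma aut_one_apply: "\<one>\<^bsub>AutoGroup G\<^esub> (el x y i) = el x y i"
  by (simp add: AutoGroup_def BijGroup_def)

sublocale Aut: group "AutoGroup G"
  by (rule AutoGroup)

lemma conj_add: "conj_by m n \<otimes>\<^bsub>AutoGroup G\<^esub> conj_by m' n' = conj_by (m + m') (n + n')"
  by (rule aut_eqI) (auto simp: conj_aut aut_mult_apply conj_el algebra_simps)

lemma conj_cong:
  assumes "m \<approx> m'" "n \<approx> n'" shows "conj_by m n = conj_by m' n'"
proof (rule aut_eqI)
  show "conj_by m n (el x y i) = conj_by m' n' (el x y i)" for x y i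
    unfolding conj_el using assms by (intro el_cong cong_add cong_mult cong_refl)
qed (rule conj_aut)+

lemma diag_cong:
  assumes "U \<approx> U'" "V \<approx> V'" "[j = j'] (mod int q ^ 2)"
    and "\<not> int p dvd U" "\<not> int p dvd V" "[j = 1] (mod int q)"
  shows "diag U V j = diag U' V' j'"
proof -
  have *: "\<not> int p dvd U'" "\<not> int p dvd V'" "[j' = 1] (mod int q)"
    using assms cong_dvd_iff cong_q2_q[OF assms(3)] by (blast, blast, simp add: cong_def)
  show ?thesis
  proof (rule aut_eqI)
    show "diag U V j (el x y i) = diag U' V' j' (el x y i)" for x y i
      unfolding diag_aut(2)[OF assms(4-6)] diag_aut(2)[OF *] using assms(1-3)
      by (intro el_cong cong_mult cong_refl)
  qed (rule diag_aut[OF assms(4-6)] diag_aut[OF *])+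
qed

lemma not_dvd_mult: "\<not> int p dvd U \<Longrightarrow> \<not> int p dvd V \<Longrightarrow> \<not> int p dvd U * V"
  by (simp add: prime_dvd_mult_iff[OF prime_p])

lemma diag_mult:
  assumes "\<not> int p dvd U" "\<not> int p dvd V" "[j = 1] (mod int q)"
    and "\<not> int p dvd U'" "\<not> int p dvd V'" "[j' = 1] (mod int q)"
  shows "diag U V j \<otimes>\<^bsub>AutoGroup G\<^esub> diag U' V' j' = diag (U * U') (V * V') (j * j')"
proof -
  have "[j * j' = 1] (mod int q)" using cong_mult[OF assms(3) assms(6)] by simp
  note * = not_dvd_mult[OF assms(1,4)] not_dvd_mult[OF assms(2,5)] this
  note d = diag_aut[OF assms(1-3)] diag_aut[OF assms(4-6)] diag_aut[OF *]
  show ?thesis by (rule aut_eqI) (auto simp: d aut_mult_apply mult.assoc)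
qed

lemma swap_swap: "swap \<otimes>\<^bsub>AutoGroup G\<^esub> swap = \<one>\<^bsub>AutoGroup G\<^esub>"
  by (rule aut_eqI) (auto simp: swap_aut aut_mult_apply swap_el aut_one_apply)

lemma swap_diag:
  assumes "\<not> int p dvd U" "\<not> int p dvd V" "[j = 1] (mod int q)"
  shows "swap \<otimes>\<^bsub>AutoGroup G\<^esub> diag U V j = diag V U j \<otimes>\<^bsub>AutoGroup G\<^esub> swap"
  by (rule aut_eqI)
    (auto simp: swap_aut diag_aut[OF assms] diag_aut[OF assms(2,1,3)] aut_mult_apply swap_el)

lemma swap_conj: "swap \<otimes>\<^bsub>AutoGroup G\<^esub> conj_by m n = conj_by n m \<otimes>\<^bsub>AutoGroup G\<^esub> swap"
  by (rule aut_eqI) (auto simp: swap_aut conj_aut aut_mult_apply swap_el conj_el)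

text \<open>
  An automorphism \<open>h\<close> turns conjugation by \<open>g\<close> into conjugation by \<open>h g\<close>. Together with the lemma
  \<open>swap_conj\<close> this is the action of the stabiliser of \<open>\<langle>a\<rangle>\<close> on the inner part.
\<close>
lemma diag_conj:
  assumes "\<not> int p dvd U" "\<not> int p dvd V" "[j = 1] (mod int q)"
  shows "diag U V j \<otimes>\<^bsub>AutoGroup G\<^esub> conj_by m n = conj_by (U * m) (V * n) \<otimes>\<^bsub>AutoGroup G\<^esub> diag U V j"
proof (rule aut_eqI)
  fix x y i
  have w: "w i \<approx> w (j * i)" for i
    unfolding w_cong_iff using cong_mult[OF assms(3) cong_refl[of i]] by (simp add: cong_sym)
  have aux: "U * (x + (1 - w i) * m) \<approx> U * x + (1 - w (j * i)) * (U * m)" for U x i m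
  proof -
    have "U * (x + (1 - w i) * m) \<approx> U * (x + (1 - w (j * i)) * m)"
      by (intro cong_add cong_mult cong_diff cong_refl w)
    then show ?thesis by (simp add: algebra_simps)
  qed
  show "(diag U V j \<otimes>\<^bsub>AutoGroup G\<^esub> conj_by m n) (el x y i) =
      (conj_by (U * m) (V * n) \<otimes>\<^bsub>AutoGroup G\<^esub> diag U V j) (el x y i)"
    using aux[of U x i m] aux[of V y "-i" n]
    by (auto simp: diag_aut[OF assms] conj_aut aut_mult_apply conj_el intro!: el_cong)
qed (auto simp: diag_aut[OF assms] conj_aut)

section \<open>Decomposition of an arbitrary automorphism\<close>

lemma el_eq_one_iff: "el x y i = \<one> \<longleftrightarrow> x \<approx> 0 \<and> y \<approx> 0 \<and> [i = 0] (mod int q ^ 2)"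
  by (simp add: one_eq el_eq_iff)

lemma el_kernel_pow: "el \<alpha> \<beta> 0 [^] (x::int) = el (\<alpha> * x) (\<beta> * x) 0"
proof -
  have "a * x + w 0 * (a * y) \<approx> a * x + a * y" for a x y
    by (intro cong_add cong_refl w_0_mult)
  then have "a * (x + y) \<approx> a * x + w 0 * (a * y)" for a x y
    by (simp add: distrib_left cong_sym)
  then have *: "el (\<alpha> * (x + y)) (\<beta> * (x + y)) 0 = el (\<alpha> * x) (\<beta> * x) 0 \<otimes> el (\<alpha> * y) (\<beta> * y) 0" for x y
    by (simp add: el_mult el_eq_iff)
  show ?thesis
    using int_pow_eq_of_add_mult[of "\<lambda>x. el (\<alpha> * x) (\<beta> * x) 0" x] * by simp
qed

lemma el_top_pow: "el 0 0 1 [^] (i::int) = el 0 0 i"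
  by (rule int_pow_eq_of_add_mult) (simp_all add: el_mult)

lemma el_as_powers: "el x y i = el 1 0 0 [^] x \<otimes> el 0 1 0 [^] y \<otimes> el 0 0 1 [^] i"
  unfolding el_kernel_pow el_top_pow using w_0_mult[of y]
  by (auto simp: el_mult intro!: el_cong dest: cong_sym)

lemma el_pow_last: "\<exists>x' y'. el x y i [^] (n::nat) = el x' y' (int n * i)"
proof (induction n)
  case 0 then show ?case by (auto simp: one_eq)
next
  case (Suc n)
  then obtain x' y' where "el x y i [^] n = el x' y' (int n * i)" by blast
  then show ?case by (auto simp: el_mult algebra_simps)
qed

lemma aut_group_hom: "f \<in> carrier (AutoGroup G) \<Longrightarrow> group_hom G G f"
  by unfold_locales (simp add: auto_group_carrier)

lemma aut_eq_one_iff: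
  assumes "f \<in> carrier (AutoGroup G)" "g \<in> carrier G"
  shows "f g = \<one> \<longleftrightarrow> g = \<one>"
proof -
  interpret f: group_hom G G f using assms(1) by (rule aut_group_hom)
  show ?thesis using assms f.hom_one unfolding auto_group_carrier bij_betw_def
    by (metis inj_onD one_closed)
qed

lemma aut_eqI_generators:
  assumes f: "f \<in> carrier (AutoGroup G)" and g: "g \<in> carrier (AutoGroup G)"
    and "f (el 1 0 0) = g (el 1 0 0)" "f (el 0 1 0) = g (el 0 1 0)" "f (el 0 0 1) = g (el 0 0 1)"
  shows "f = g"
proof (rule aut_eqI[OF f g])
  interpret f: group_hom G G f using f by (rule aut_group_hom)
  interpret g: group_hom G G g using g by (rule aut_group_hom)
  show "f (el x y i) = g (el x y i)" for x y i
    unfolding el_as_powers[of x y i] using assms(3-)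
    by (simp add: f.hom_int_pow g.hom_int_pow)
qed

text \<open>
  The elements \<open>el x y 0\<close> are killed by \<open>p\<close>, and so are their images; the last coordinate of such an
  image vanishes because \<open>p\<close> is invertible modulo \<open>q\<^sup>2\<close>.
\<close>
lemma aut_preserves_kernel:
  assumes f: "f \<in> carrier (AutoGroup G)"
  obtains \<alpha> \<beta> where "f (el x y 0) = el \<alpha> \<beta> 0"
proof -
  interpret f: group_hom G G f using f by (rule aut_group_hom)
  obtain \<alpha> \<beta> k where k: "f (el x y 0) = el \<alpha> \<beta> k"
    using el_cases[OF f.hom_closed[OF el_closed[of x y 0]]] by metis
  obtain x' y' where "el \<alpha> \<beta> k [^] p = el x' y' (int p * k)"
    using el_pow_last by blast
  moreover have "el x y 0 [^] p = \<one>"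
    using el_kernel_pow[of x y "int p"] by (simp add: int_pow_int el_eq_one_iff cong_def)
  then have "el \<alpha> \<beta> k [^] p = \<one>"
    using f.hom_nat_pow[of "el x y 0" p] k by simp
  ultimately have "el x' y' (int p * k) = \<one>" by simp
  then have "int q ^ 2 dvd int p * k"
    by (simp add: el_eq_one_iff cong_0_iff)
  moreover have "coprime (int q ^ 2) (int p)"
    using primes_coprime[OF prime_q prime_p] p_neq_q by simp
  ultimately have "int q ^ 2 dvd k"
    by (simp add: coprime_dvd_mult_right_iff)
  then have "el \<alpha> \<beta> k = el \<alpha> \<beta> 0"
    by (intro el_cong cong_refl) (simp add: cong_0_iff)
  then show ?thesis using that k by simp
qed

lemma w_eigenvalue: "w i * x \<approx> w j * x \<Longrightarrow> x \<approx> 0 \<or> [i = j] (mod int q)"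
  using cancel_unit[of x "w i" "w j"] w_cong_iff[of i j]
  by (metis cong_0_iff mult.commute)

lemma not_cong_1_minus_1: "\<not> [1 = - 1] (mod int q)"
proof
  assume "[1 = - 1] (mod int q)"
  then have "int q dvd 2" by (simp add: cong_iff_dvd_diff)
  then have "q dvd 2" by presburger
  then show False using q q_odd primes_dvd_imp_eq two_is_prime_nat by blast
qed

lemma not_dvd_one_minus_w: "\<not> int q dvd i \<Longrightarrow> \<not> int p dvd 1 - w i"
  using w_eq_1_iff[of i] by (metis cong_iff_dvd_diff cong_sym)

lemma solve_cong_p:
  assumes "\<not> int p dvd u" obtains z where "u * z \<approx> y"
proof -
  have "coprime u (int p)"
    using prime_imp_coprime[OF prime_p assms] by (simp add: coprime_commute)
  then obtain v where "u * v \<approx> 1" using cong_solve_coprime_int by blast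
  from cong_mult[OF this cong_refl[of y]] have "u * (v * y) \<approx> y" by (simp add: mult.assoc)
  then show ?thesis by (rule that)
qed

definition twist :: "bool \<Rightarrow> 'a \<Rightarrow> 'a" where
  "twist \<epsilon> = (if \<epsilon> then swap else \<one>\<^bsub>AutoGroup G\<^esub>)"

lemma twist_aut [simp]: "twist \<epsilon> \<in> carrier (AutoGroup G)"
  by (simp add: twist_def swap_aut)

lemma twist_el: "twist \<epsilon> (el x y i) = (if \<epsilon> then el y x (- i) else el x y i)"
  by (simp add: twist_def swap_el aut_one_apply)

text \<open>
  The images of \<open>b\<close> and \<open>c\<close> are eigenvectors of conjugation by \<open>f(a)\<close>, hence of \<open>a\<^sup>i\<close>, for the old
  eigenvalues \<open>w 1\<close> and \<open>w (- 1)\<close>. A nonzero \<open>b\<close>-coordinate \<open>\<alpha>\<close> of \<open>f(b)\<close> gives \<open>i \<equiv> 1\<close> modulo \<open>q\<close>,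
  a nonzero \<open>c\<close>-coordinate \<open>\<beta>\<close> gives \<open>i \<equiv> -1\<close>; as \<open>q\<close> is odd only one of them occurs, and
  for \<open>f(c)\<close> the two cases are exchanged.
\<close>
lemma aut_decomposition:
  assumes f: "f \<in> carrier (AutoGroup G)"
  obtains m n U V j \<epsilon> where "\<not> int p dvd U" "\<not> int p dvd V" "[j = 1] (mod int q)"
    and "f = conj_by m n \<otimes>\<^bsub>AutoGroup G\<^esub> (diag U V j \<otimes>\<^bsub>AutoGroup G\<^esub> twist \<epsilon>)"
proof -
  interpret f: group_hom G G f using f by (rule aut_group_hom)
  obtain \<alpha> \<beta> where b: "f (el 1 0 0) = el \<alpha> \<beta> 0" by (rule aut_preserves_kernel[OF f])
  obtain \<gamma> \<delta> where c: "f (el 0 1 0) = el \<gamma> \<delta> 0" by (rule aut_preserves_kernel[OF f])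
  obtain m0 n0 i where a: "f (el 0 0 1) = el m0 n0 i"
    using el_cases[OF f.hom_closed[OF el_closed[of 0 0 1]]] by metis
  \<comment> \<open>the image under \<open>f\<close> of a relation \<open>a v a\<^sup>-\<^sup>1 = v\<^sup>t\<close> with \<open>v\<close> in the plane\<close>
  have rel: "w i * x' \<approx> t * x' \<and> w (- i) * y' \<approx> t * y'"
    if r: "el 0 0 1 \<otimes> el x y 0 = el x y 0 [^] t \<otimes> el 0 0 1"
      and v: "f (el x y 0) = el x' y' 0" for x y x' y' t
  proof -
    have "f (el 0 0 1) \<otimes> f (el x y 0) = f (el x y 0) [^] t \<otimes> f (el 0 0 1)"
      using arg_cong[OF r, of f] by (simp add: f.hom_int_pow)
    then have *: "m0 + w i * x' \<approx> x' * t + w 0 * m0" "n0 + w (- i) * y' \<approx> y' * t + w 0 * n0"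
      unfolding a v el_kernel_pow by (simp_all add: el_mult el_eq_iff)
    have "z * t + w 0 * n \<approx> n + t * z" for z n
      using cong_add[OF cong_refl w_0_mult[of n]] by (metis add.commute mult.commute)
    with * have "m0 + w i * x' \<approx> m0 + t * x'" "n0 + w (- i) * y' \<approx> n0 + t * y'"
      using cong_trans by blast+
    then show ?thesis by (simp add: cong_add_lcancel)
  qed
  have "w i * \<alpha> \<approx> w 1 * \<alpha> \<and> w (- i) * \<beta> \<approx> w 1 * \<beta>"
    by (rule rel[OF _ b]) (auto simp: el_kernel_pow el_mult)
  then have rb: "\<alpha> \<approx> 0 \<or> [i = 1] (mod int q)" "\<beta> \<approx> 0 \<or> [- i = 1] (mod int q)"
    using w_eigenvalue by blast+
  have "w i * \<gamma> \<approx> w (- 1) * \<gamma> \<and> w (- i) * \<delta> \<approx> w (- 1) * \<delta>"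
    by (rule rel[OF _ c]) (auto simp: el_kernel_pow el_mult)
  then have rc: "\<gamma> \<approx> 0 \<or> [i = - 1] (mod int q)" "\<delta> \<approx> 0 \<or> [- i = - 1] (mod int q)"
    using w_eigenvalue by blast+
  have nzb: "\<not> (\<alpha> \<approx> 0 \<and> \<beta> \<approx> 0)"
    using aut_eq_one_iff[OF f el_closed[of 1 0 0]] prime_gt_1_nat[OF p] by (simp add: b el_eq_one_iff cong_0_iff)
  have nzc: "\<not> (\<gamma> \<approx> 0 \<and> \<delta> \<approx> 0)"
    using aut_eq_one_iff[OF f el_closed[of 0 1 0]] prime_gt_1_nat[OF p] by (simp add: c el_eq_one_iff cong_0_iff)
  have neg: "[- x = y] (mod int q) \<longleftrightarrow> [x = - y] (mod int q)" for x y
    using cong_minus_minus_iff[of x "- y" "int q"] by simp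
  have excl: "\<not> ([i = 1] (mod int q) \<and> [i = - 1] (mod int q))"
    using not_cong_1_minus_1 by (meson cong_sym cong_trans)
  have i: "[i = 1] (mod int q) \<or> [i = - 1] (mod int q)"
    using rb nzb neg by blast
  have "\<not> int q dvd 1" using prime_q not_prime_unit by blast
  then have qi: "\<not> int q dvd i" "\<not> int q dvd - i"
    using i cong_dvd_iff[of i 1 "int q"] cong_dvd_iff[of i "-1" "int q"] by auto
  \<comment> \<open>the coordinates of the inner automorphism that carries \<open>a\<^sup>i\<close> to \<open>f(a)\<close>\<close>
  obtain m where m: "(1 - w i) * m \<approx> m0"
    by (rule solve_cong_p[OF not_dvd_one_minus_w[OF qi(1)]])
  obtain n where n: "(1 - w (- i)) * n \<approx> n0"
    by (rule solve_cong_p[OF not_dvd_one_minus_w[OF qi(2)]])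
  have w0: "(1 - w 0) * z \<approx> 0" for z
    using cong_mult[OF cong_diff[OF cong_refl w_0] cong_refl[of z], of 1] by simp
  then have w0': "x \<approx> 0 \<Longrightarrow> x \<approx> (1 - w 0) * z" for x z
    by (meson cong_sym cong_trans)
  show ?thesis
  proof (cases "[i = 1] (mod int q)")
    case True
    with rb rc neg excl nzb nzc have z: "\<beta> \<approx> 0" "\<gamma> \<approx> 0" and u: "\<not> int p dvd \<alpha>" "\<not> int p dvd \<delta>"
      by (auto simp: cong_0_iff)
    note d = diag_aut[OF u True]
    have "f = conj_by m n \<otimes>\<^bsub>AutoGroup G\<^esub> (diag \<alpha> \<delta> i \<otimes>\<^bsub>AutoGroup G\<^esub> twist False)"
    proof (rule aut_eqI_generators[OF f])
      show "f (el 1 0 0) = (conj_by m n \<otimes>\<^bsub>AutoGroup G\<^esub> (diag \<alpha> \<delta> i \<otimes>\<^bsub>AutoGroup G\<^esub> twist False)) (el 1 0 0)"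
        "f (el 0 1 0) = (conj_by m n \<otimes>\<^bsub>AutoGroup G\<^esub> (diag \<alpha> \<delta> i \<otimes>\<^bsub>AutoGroup G\<^esub> twist False)) (el 0 1 0)"
        using z w0' cong_add[OF cong_refl w0]
        by (auto simp: aut_mult_apply d conj_aut conj_el twist_el b c el_eq_iff intro: cong_sym cong_trans)
      show "f (el 0 0 1) = (conj_by m n \<otimes>\<^bsub>AutoGroup G\<^esub> (diag \<alpha> \<delta> i \<otimes>\<^bsub>AutoGroup G\<^esub> twist False)) (el 0 0 1)"
        using m n by (auto simp: aut_mult_apply d conj_aut conj_el twist_el a el_eq_iff intro: cong_sym)
    qed (use d conj_aut in simp)
    with that u True show ?thesis by blast
  next
    case False
    with i have i': "[- i = 1] (mod int q)" using neg by blast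
    with False rb rc neg nzb nzc have z: "\<alpha> \<approx> 0" "\<delta> \<approx> 0" and u: "\<not> int p dvd \<gamma>" "\<not> int p dvd \<beta>"
      by (auto simp: cong_0_iff)
    note d = diag_aut[OF u i']
    have "f = conj_by m n \<otimes>\<^bsub>AutoGroup G\<^esub> (diag \<gamma> \<beta> (- i) \<otimes>\<^bsub>AutoGroup G\<^esub> twist True)"
    proof (rule aut_eqI_generators[OF f])
      show "f (el 1 0 0) = (conj_by m n \<otimes>\<^bsub>AutoGroup G\<^esub> (diag \<gamma> \<beta> (- i) \<otimes>\<^bsub>AutoGroup G\<^esub> twist True)) (el 1 0 0)"
        "f (el 0 1 0) = (conj_by m n \<otimes>\<^bsub>AutoGroup G\<^esub> (diag \<gamma> \<beta> (- i) \<otimes>\<^bsub>AutoGroup G\<^esub> twist True)) (el 0 1 0)"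
        using z w0' cong_add[OF cong_refl w0]
        by (auto simp: aut_mult_apply d conj_aut conj_el twist_el b c el_eq_iff intro: cong_sym cong_trans)
      show "f (el 0 0 1) = (conj_by m n \<otimes>\<^bsub>AutoGroup G\<^esub> (diag \<gamma> \<beta> (- i) \<otimes>\<^bsub>AutoGroup G\<^esub> twist True)) (el 0 0 1)"
        using m n by (auto simp: aut_mult_apply d conj_aut conj_el twist_el a el_eq_iff intro: cong_sym)
    qed (use d conj_aut in simp)
    with that u i' show ?thesis by blast
  qed
qed

lemma diag_eqD:
  assumes "\<not> int p dvd U" "\<not> int p dvd V" "[j = 1] (mod int q)"
    and "\<not> int p dvd U'" "\<not> int p dvd V'" "[j' = 1] (mod int q)"
    and "diag U V j = diag U' V' j'"
  shows "U \<approx> U'" "V \<approx> V'" "[j = j'] (mod int q ^ 2)"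
proof -
  have "el (U * x) (V * y) (j * i) = el (U' * x) (V' * y) (j' * i)" for x y i
    using diag_aut(2)[OF assms(1-3)] diag_aut(2)[OF assms(4-6)] assms(7) by metis
  from this[of 1 1 1] show "U \<approx> U'" "V \<approx> V'" "[j = j'] (mod int q ^ 2)"
    by (simp_all add: el_eq_iff)
qed

text \<open>
  The image of \<open>a\<close> already determines everything but \<open>U\<close> and \<open>V\<close>: its last coordinate is \<open>j\<close> or
  \<open>- j\<close>, and the sign is visible modulo the odd prime \<open>q\<close>, while the other coordinates are invertible
  multiples of \<open>m\<close> and \<open>n\<close>.
\<close>
lemma aut_decomposition_unique:
  assumes d: "\<not> int p dvd U" "\<not> int p dvd V" "[j = 1] (mod int q)"
    and d': "\<not> int p dvd U'" "\<not> int p dvd V'" "[j' = 1] (mod int q)"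
    and eq: "conj_by m n \<otimes>\<^bsub>AutoGroup G\<^esub> (diag U V j \<otimes>\<^bsub>AutoGroup G\<^esub> twist \<epsilon>) =
      conj_by m' n' \<otimes>\<^bsub>AutoGroup G\<^esub> (diag U' V' j' \<otimes>\<^bsub>AutoGroup G\<^esub> twist \<epsilon>')"
  shows "m \<approx> m'" "n \<approx> n'" "diag U V j = diag U' V' j'" "\<epsilon> = \<epsilon>'"
proof -
  define i where "i = (if \<epsilon> then - j else j)"
  define i' where "i' = (if \<epsilon>' then - j' else j')"
  have "el ((1 - w i) * m) ((1 - w (- i)) * n) i = el ((1 - w i') * m') ((1 - w (- i')) * n') i'"
    using fun_cong[OF eq, of "el 0 0 1"]
    by (simp add: aut_mult_apply diag_aut[OF d] diag_aut[OF d'] conj_aut conj_el twist_el i_def i'_def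
        split: if_splits)
  then have e: "(1 - w i) * m \<approx> (1 - w i') * m'" "(1 - w (- i)) * n \<approx> (1 - w (- i')) * n'"
    and ii: "[i = i'] (mod int q ^ 2)" by (simp_all add: el_eq_iff)
  have ii': "[- i = - i'] (mod int q ^ 2)" using ii by (simp add: cong_minus_minus_iff)
  have i1: "[i = (if \<epsilon> then - 1 else 1)] (mod int q)" "[i' = (if \<epsilon>' then - 1 else 1)] (mod int q)"
    using d(3) d'(3) by (auto simp: i_def i'_def cong_minus_minus_iff)
  have "[(if \<epsilon> then - 1 else 1) = (if \<epsilon>' then - 1 else 1 :: int)] (mod int q)"
    using cong_q2_q[OF ii] i1 by (meson cong_sym cong_trans)
  then show \<epsilon>: "\<epsilon> = \<epsilon>'"
    using not_cong_1_minus_1 by (auto split: if_splits dest: cong_sym)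
  have "\<not> int q dvd 1" using prime_q not_prime_unit by blast
  then have qi: "\<not> int q dvd i" "\<not> int q dvd - i"
    using cong_dvd_iff[OF i1(1)] by (auto split: if_splits)
  have "(1 - w i') * m' \<approx> (1 - w i) * m'" "(1 - w (- i')) * n' \<approx> (1 - w (- i)) * n'"
    using w_cong[OF ii] w_cong[OF ii'] by (auto intro!: cong_mult cong_diff dest: cong_sym)
  with e have "(1 - w i) * m \<approx> (1 - w i) * m'" "(1 - w (- i)) * n \<approx> (1 - w (- i)) * n'"
    using cong_trans by blast+
  then show m: "m \<approx> m'" and n: "n \<approx> n'"
    using cancel_unit not_dvd_one_minus_w qi by blast+
  show "diag U V j = diag U' V' j'"
    using eq conj_cong[OF m n] \<epsilon> diag_aut(1)[OF d] diag_aut(1)[OF d'] conj_aut by simp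
qed

section \<open>The automorphism group as an iterated semidirect product\<close>

lemma one_plus_cong: "[1 + int q * k = 1] (mod int q)"
  by (simp add: cong_iff_dvd_diff)

lemma one_plus_cong_iff: "[1 + int q * k = 1 + int q * k'] (mod int q ^ 2) \<longleftrightarrow> [k = k'] (mod int q)"
proof -
  have "int q * int q dvd int q * (k - k') \<longleftrightarrow> int q dvd k - k'"
    using prime_gt_0_nat[OF q] by simp
  then show ?thesis by (simp add: cong_iff_dvd_diff power2_eq_square right_diff_distrib)
qed

lemma mod_group_cong: "n > 0 \<Longrightarrow> a \<in> carrier (integer_mod_group n) \<Longrightarrow> b \<in> carrier (integer_mod_group n) \<Longrightarrow>
    [a = b] (mod int n) \<Longrightarrow> a = b"
  by (auto simp: carrier_integer_mod_group intro: cong_less_imp_eq_int)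

lemma mod_group_closed: "n > 0 \<Longrightarrow> a mod int n \<in> carrier (integer_mod_group n)"
  by (simp add: carrier_integer_mod_group)

text \<open>
  Any exponential \<open>e\<close> modulo \<open>p\<close> parametrises \<open>U\<close> and \<open>V\<close> additively, and \<open>k \<mapsto> 1 + q k\<close> does the
  same for the exponents \<open>j\<close>, because \<open>(1 + q k)(1 + q k')\<close> and \<open>1 + q (k + k')\<close> differ by a multiple
  of \<open>q\<^sup>2\<close>.
\<close>
lemma aut_group_structure:
  fixes e :: "int \<Rightarrow> int"
  assumes e_add: "\<And>u v. e (u + v) \<approx> e u * e v"
    and e_cong_iff: "\<And>u v. e u \<approx> e v \<longleftrightarrow> [u = v] (mod int (p - 1))"
    and e_surj: "\<And>x. \<not> int p dvd x \<Longrightarrow> \<exists>u. x \<approx> e u"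
    and e_0: "e 0 = 1"
  shows "\<exists>\<psi> \<phi>.
    \<psi> \<in> hom (integer_mod_group 2)
          (AutoGroup ((integer_mod_group (p - 1) \<times>\<times> integer_mod_group (p - 1)) \<times>\<times> integer_mod_group q)) \<and>
    \<phi> \<in> hom
          (semidirect_product
            ((integer_mod_group (p - 1) \<times>\<times> integer_mod_group (p - 1)) \<times>\<times> integer_mod_group q)
            (integer_mod_group 2) \<psi>)
          (AutoGroup (integer_mod_group p \<times>\<times> integer_mod_group p)) \<and>
    AutoGroup G \<cong>
      semidirect_product (integer_mod_group p \<times>\<times> integer_mod_group p)
        (semidirect_product
          ((integer_mod_group (p - 1) \<times>\<times> integer_mod_group (p - 1)) \<times>\<times> integer_mod_group q)
          (integer_mod_group 2) \<psi>)
        \<phi>"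
proof -
  define K where "K = (integer_mod_group (p - 1) \<times>\<times> integer_mod_group (p - 1)) \<times>\<times> integer_mod_group q"
  define Z2 where "Z2 = integer_mod_group 2"
  define N where "N = integer_mod_group p \<times>\<times> integer_mod_group p"
  have pos: "p - 1 > 0" "p > 0" "q > 0"
    using prime_gt_1_nat[OF p] prime_gt_0_nat[OF q] by simp_all
  have grp: "group K" "group Z2" "group N"
    by (simp_all add: K_def Z2_def N_def DirProd_group)
  have Z2_cases: "\<epsilon> = 0 \<or> \<epsilon> = 1" if "\<epsilon> \<in> carrier Z2" for \<epsilon>
    using that by (auto simp: Z2_def carrier_integer_mod_group)
  have e_unit: "\<not> int p dvd e u" for u
    using not_dvd_of_add_mult[OF p e_add] e_0 by simp
  note de = diag_aut[OF e_unit e_unit one_plus_cong]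

  define \<delta> where "\<delta> = (\<lambda>((u, v), k). diag (e u) (e v) (1 + int q * k))"
  define \<tau> where "\<tau> = (\<lambda>\<epsilon>::int. twist (\<epsilon> = 1))"
  define \<gamma> where "\<gamma> = (\<lambda>(m, n). conj_by m n)"
  have \<delta>_hom: "\<delta> \<in> hom K (AutoGroup G)"
  proof (rule homI)
    fix x y assume "x \<in> carrier K" "y \<in> carrier K"
    obtain u v k u' v' k' where x: "x = ((u, v), k)" and y: "y = ((u', v'), k')"
      by (metis surj_pair)
    have ee: "e ((u + v) mod int (p - 1)) \<approx> e u * e v" for u v
      using e_add[of u v] e_cong_iff[of "(u + v) mod int (p - 1)" "u + v"]
      by (meson cong_mod_left cong_refl cong_trans)
    have "(1 + int q * k) * (1 + int q * k') = (1 + int q * (k + k')) + int q ^ 2 * (k * k')"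
      by (simp add: algebra_simps power2_eq_square)
    then have "[(1 + int q * k) * (1 + int q * k') = 1 + int q * (k + k')] (mod int q ^ 2)"
      by (simp add: cong_def)
    moreover have "[1 + int q * ((k + k') mod int q) = 1 + int q * (k + k')] (mod int q ^ 2)"
      unfolding one_plus_cong_iff by simp
    ultimately have kk: "[1 + int q * ((k + k') mod int q) = (1 + int q * k) * (1 + int q * k')] (mod int q ^ 2)"
      by (meson cong_sym cong_trans)
    have "\<delta> (x \<otimes>\<^bsub>K\<^esub> y) = diag (e ((u + u') mod int (p - 1))) (e ((v + v') mod int (p - 1)))
        (1 + int q * ((k + k') mod int q))"
      by (simp add: \<delta>_def x y K_def DirProd_def)
    also have "\<dots> = diag (e u * e u') (e v * e v') ((1 + int q * k) * (1 + int q * k'))"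
      by (intro diag_cong ee kk e_unit one_plus_cong)
    also have "\<dots> = \<delta> x \<otimes>\<^bsub>AutoGroup G\<^esub> \<delta> y"
      by (simp add: \<delta>_def x y diag_mult e_unit one_plus_cong)
    finally show "\<delta> (x \<otimes>\<^bsub>K\<^esub> y) = \<delta> x \<otimes>\<^bsub>AutoGroup G\<^esub> \<delta> y" .
  qed (auto simp: \<delta>_def de)
  have \<delta>_inj: "inj_on \<delta> (carrier K)"
  proof (rule inj_onI)
    fix x y assume xy: "x \<in> carrier K" "y \<in> carrier K" "\<delta> x = \<delta> y"
    obtain u v k u' v' k' where x: "x = ((u, v), k)" and y: "y = ((u', v'), k')"
      by (metis surj_pair)
    have "diag (e u) (e v) (1 + int q * k) = diag (e u') (e v') (1 + int q * k')"
      using xy(3) by (simp add: x y \<delta>_def)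
    note diag_eqD[OF e_unit e_unit one_plus_cong e_unit e_unit one_plus_cong this]
    then have "[u = u'] (mod int (p - 1))" "[v = v'] (mod int (p - 1))" "[k = k'] (mod int q)"
      by (simp_all only: e_cong_iff one_plus_cong_iff)
    moreover have "u \<in> carrier (integer_mod_group (p - 1))" "u' \<in> carrier (integer_mod_group (p - 1))"
      "v \<in> carrier (integer_mod_group (p - 1))" "v' \<in> carrier (integer_mod_group (p - 1))"
      "k \<in> carrier (integer_mod_group q)" "k' \<in> carrier (integer_mod_group q)"
      using xy(1,2) by (simp_all add: x y K_def DirProd_def)
    ultimately show "x = y" using mod_group_cong pos unfolding x y by blast
  qed
  have \<tau>_hom: "\<tau> \<in> hom Z2 (AutoGroup G)"
  proof (rule homI)
    fix x y assume "x \<in> carrier Z2" "y \<in> carrier Z2"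
    then show "\<tau> (x \<otimes>\<^bsub>Z2\<^esub> y) = \<tau> x \<otimes>\<^bsub>AutoGroup G\<^esub> \<tau> y"
      using Z2_cases[of x] Z2_cases[of y] swap_aut
      by (auto simp: \<tau>_def twist_def Z2_def swap_swap)
  qed (simp add: \<tau>_def)
  have norm1: "\<exists>x'\<in>carrier K. \<tau> \<epsilon> \<otimes>\<^bsub>AutoGroup G\<^esub> \<delta> x = \<delta> x' \<otimes>\<^bsub>AutoGroup G\<^esub> \<tau> \<epsilon>"
    if x: "x \<in> carrier K" for \<epsilon> x
  proof -
    obtain u v k where xx: "x = ((u, v), k)" by (metis surj_pair)
    have "((v, u), k) \<in> carrier K" using x by (auto simp: xx K_def DirProd_def)
    moreover have "swap \<otimes>\<^bsub>AutoGroup G\<^esub> \<delta> x = \<delta> ((v, u), k) \<otimes>\<^bsub>AutoGroup G\<^esub> swap"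
      by (simp add: xx \<delta>_def swap_diag e_unit one_plus_cong)
    ultimately show ?thesis
      using x \<delta>_hom by (cases "\<epsilon> = 1") (auto simp: \<tau>_def twist_def hom_def Pi_iff)
  qed
  obtain \<psi> where \<psi>: "\<psi> \<in> hom Z2 (AutoGroup K)"
    and \<beta>_hom: "(\<lambda>(x, \<epsilon>). \<delta> x \<otimes>\<^bsub>AutoGroup G\<^esub> \<tau> \<epsilon>) \<in> hom (semidirect_product K Z2 \<psi>) (AutoGroup G)"
    by (rule semidirect_hom[OF Aut.group_axioms grp(1,2) \<delta>_hom \<delta>_inj \<tau>_hom norm1])
  define H where "H = semidirect_product K Z2 \<psi>"
  define \<beta> where "\<beta> = (\<lambda>(x, \<epsilon>). \<delta> x \<otimes>\<^bsub>AutoGroup G\<^esub> \<tau> \<epsilon>)"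
  have H: "group H" unfolding H_def by (rule group_semidirect_product[OF grp(1,2) \<psi>])
  note \<beta>_hom = \<beta>_hom[folded H_def \<beta>_def]
  have H_carrier: "carrier H = carrier K \<times> carrier Z2"
    by (simp add: H_def semidirect_product_def)

  have \<gamma>_hom: "\<gamma> \<in> hom N (AutoGroup G)"
    by (rule homI)
      (auto simp: \<gamma>_def N_def DirProd_def conj_aut conj_add intro!: conj_cong)
  have \<gamma>_eqD: "x = y" if xy: "x \<in> carrier N" "y \<in> carrier N" and "fst x \<approx> fst y" "snd x \<approx> snd y" for x y
    using that mod_group_cong[OF pos(2)] by (intro prod_eqI) (auto simp: N_def DirProd_def)
  \<comment> \<open>uniqueness of the decomposition, in terms of the three parametrisations\<close>
  have tw: "fst x \<approx> fst y \<and> snd x \<approx> snd y \<and> \<delta> z = \<delta> z' \<and> (\<epsilon> = 1 \<longleftrightarrow> \<epsilon>' = 1)"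
    if "\<gamma> x \<otimes>\<^bsub>AutoGroup G\<^esub> (\<delta> z \<otimes>\<^bsub>AutoGroup G\<^esub> \<tau> \<epsilon>) = \<gamma> y \<otimes>\<^bsub>AutoGroup G\<^esub> (\<delta> z' \<otimes>\<^bsub>AutoGroup G\<^esub> \<tau> \<epsilon>')" for x y z z' \<epsilon> \<epsilon>'
  proof -
    obtain u v k u' v' k' m n m' n' where "z = ((u, v), k)" "z' = ((u', v'), k')" "x = (m, n)" "y = (m', n')"
      by (metis surj_pair)
    with that show ?thesis
      using aut_decomposition_unique[OF e_unit e_unit one_plus_cong e_unit e_unit one_plus_cong]
      by (simp add: \<gamma>_def \<delta>_def \<tau>_def)
  qed
  have \<gamma>_inj: "inj_on \<gamma> (carrier N)"
  proof (rule inj_onI)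
    fix x y assume xy: "x \<in> carrier N" "y \<in> carrier N" "\<gamma> x = \<gamma> y"
    show "x = y"
      using tw[of x "((0, 0), 0)" 0 y "((0, 0), 0)" 0] xy by (intro \<gamma>_eqD) auto
  qed
  have norm2: "\<exists>x'\<in>carrier N. \<beta> h \<otimes>\<^bsub>AutoGroup G\<^esub> \<gamma> x = \<gamma> x' \<otimes>\<^bsub>AutoGroup G\<^esub> \<beta> h"
    if h: "h \<in> carrier H" and x: "x \<in> carrier N" for h x
  proof -
    obtain u v k \<epsilon> m n where hh: "h = (((u, v), k), \<epsilon>)" and xx: "x = (m, n)"
      by (metis surj_pair)
    define m' where "m' = (if \<epsilon> = 1 then n else m)"
    define n' where "n' = (if \<epsilon> = 1 then m else n)"
    let ?d = "diag (e u) (e v) (1 + int q * k)"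
    have "\<tau> \<epsilon> \<otimes>\<^bsub>AutoGroup G\<^esub> conj_by m n = conj_by m' n' \<otimes>\<^bsub>AutoGroup G\<^esub> \<tau> \<epsilon>"
      by (simp add: \<tau>_def twist_def m'_def n'_def swap_conj conj_aut)
    then have "\<beta> h \<otimes>\<^bsub>AutoGroup G\<^esub> \<gamma> x = ?d \<otimes>\<^bsub>AutoGroup G\<^esub> (conj_by m' n' \<otimes>\<^bsub>AutoGroup G\<^esub> \<tau> \<epsilon>)"
      by (simp add: hh xx \<beta>_def \<gamma>_def \<delta>_def Aut.m_assoc de conj_aut \<tau>_def)
    also have "\<dots> = (?d \<otimes>\<^bsub>AutoGroup G\<^esub> conj_by m' n') \<otimes>\<^bsub>AutoGroup G\<^esub> \<tau> \<epsilon>"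
      by (simp add: Aut.m_assoc de conj_aut \<tau>_def)
    also have "?d \<otimes>\<^bsub>AutoGroup G\<^esub> conj_by m' n' = conj_by (e u * m') (e v * n') \<otimes>\<^bsub>AutoGroup G\<^esub> ?d"
      by (rule diag_conj[OF e_unit e_unit one_plus_cong])
    also have "conj_by (e u * m') (e v * n') = conj_by (e u * m' mod int p) (e v * n' mod int p)"
      by (rule conj_cong) simp_all
    also have "\<dots> = \<gamma> (e u * m' mod int p, e v * n' mod int p)"
      by (simp add: \<gamma>_def)
    finally have "\<beta> h \<otimes>\<^bsub>AutoGroup G\<^esub> \<gamma> x = \<gamma> (e u * m' mod int p, e v * n' mod int p) \<otimes>\<^bsub>AutoGroup G\<^esub> \<beta> h"
      by (simp add: hh \<beta>_def \<gamma>_def \<delta>_def Aut.m_assoc de conj_aut \<tau>_def)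
    moreover have "(e u * m' mod int p, e v * n' mod int p) \<in> carrier N"
      using pos by (simp add: N_def DirProd_def mod_group_closed)
    ultimately show ?thesis by blast
  qed
  obtain \<phi> where \<phi>: "\<phi> \<in> hom H (AutoGroup N)"
    and hom: "(\<lambda>(x, h). \<gamma> x \<otimes>\<^bsub>AutoGroup G\<^esub> \<beta> h) \<in> hom (semidirect_product N H \<phi>) (AutoGroup G)"
    by (rule semidirect_hom[OF Aut.group_axioms grp(3) H \<gamma>_hom \<gamma>_inj \<beta>_hom norm2])
  have carrier: "carrier (semidirect_product N H \<phi>) = carrier N \<times> (carrier K \<times> carrier Z2)"
    by (simp add: semidirect_product_def H_carrier)
  have inj: "inj_on (\<lambda>(x, h). \<gamma> x \<otimes>\<^bsub>AutoGroup G\<^esub> \<beta> h) (carrier (semidirect_product N H \<phi>))"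
  proof (rule inj_onI)
    fix s t assume s: "s \<in> carrier (semidirect_product N H \<phi>)" and t: "t \<in> carrier (semidirect_product N H \<phi>)"
      and st: "(case s of (x, h) \<Rightarrow> \<gamma> x \<otimes>\<^bsub>AutoGroup G\<^esub> \<beta> h) = (case t of (x, h) \<Rightarrow> \<gamma> x \<otimes>\<^bsub>AutoGroup G\<^esub> \<beta> h)"
    obtain x z \<epsilon> y z' \<epsilon>' where s': "s = (x, (z, \<epsilon>))" and t': "t = (y, (z', \<epsilon>'))"
      by (metis surj_pair)
    note * = tw[OF st[unfolded s' t' \<beta>_def prod.case]]
    have "x = y" using s t * by (intro \<gamma>_eqD) (auto simp: carrier s' t')
    moreover have "z = z'" using s t * \<delta>_inj by (auto simp: carrier s' t' dest: inj_onD)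
    moreover have "\<epsilon> = \<epsilon>'" using s t * Z2_cases[of \<epsilon>] Z2_cases[of \<epsilon>'] by (auto simp: carrier s' t')
    ultimately show "s = t" by (simp add: s' t')
  qed
  have surj: "f \<in> (\<lambda>(x, h). \<gamma> x \<otimes>\<^bsub>AutoGroup G\<^esub> \<beta> h) ` carrier (semidirect_product N H \<phi>)"
    if f: "f \<in> carrier (AutoGroup G)" for f
  proof -
    obtain m n U V j \<epsilon> where U: "\<not> int p dvd U" and V: "\<not> int p dvd V" and j: "[j = 1] (mod int q)"
      and f: "f = conj_by m n \<otimes>\<^bsub>AutoGroup G\<^esub> (diag U V j \<otimes>\<^bsub>AutoGroup G\<^esub> twist \<epsilon>)"
      by (rule aut_decomposition[OF f])
    have e_surj': "\<exists>u. x \<approx> e (u mod int (p - 1))" if "\<not> int p dvd x" for x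
      using e_surj[OF that] e_cong_iff by (meson cong_mod_right cong_refl cong_trans)
    obtain u v where u: "U \<approx> e (u mod int (p - 1))" and v: "V \<approx> e (v mod int (p - 1))"
      using e_surj'[OF U] e_surj'[OF V] by blast
    obtain k where "j - 1 = int q * k" using j by (auto simp: cong_iff_dvd_diff)
    then have "j = 1 + int q * k" by simp
    then have k: "[j = 1 + int q * (k mod int q)] (mod int q ^ 2)"
      by (simp add: one_plus_cong_iff cong_sym)
    let ?t = "((m mod int p, n mod int p), (((u mod int (p - 1), v mod int (p - 1)), k mod int q), if \<epsilon> then 1 else 0))"
    have "?t \<in> carrier (semidirect_product N H \<phi>)"
      unfolding carrier unfolding N_def K_def Z2_def DirProd_def using pos
      by (auto simp: carrier_integer_mod_group)
    moreover have "conj_by m n = conj_by (m mod int p) (n mod int p)"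
      by (rule conj_cong) simp_all
    with diag_cong[OF u v k U V j] have "f = (case ?t of (x, h) \<Rightarrow> \<gamma> x \<otimes>\<^bsub>AutoGroup G\<^esub> \<beta> h)"
      by (simp add: f \<gamma>_def \<beta>_def \<delta>_def \<tau>_def)
    ultimately show ?thesis by (rule rev_image_eqI)
  qed
  have "(\<lambda>(x, h). \<gamma> x \<otimes>\<^bsub>AutoGroup G\<^esub> \<beta> h) \<in> iso (semidirect_product N H \<phi>) (AutoGroup G)"
    using hom inj surj hom_carrier[OF hom] unfolding iso_def bij_betw_def by blast
  then have "semidirect_product N H \<phi> \<cong> AutoGroup G" by (auto simp: is_iso_def)
  then have "AutoGroup G \<cong> semidirect_product N H \<phi>"
    by (rule group.iso_sym[OF group_semidirect_product[OF grp(3) H \<phi>]])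
  with \<psi> \<phi> show ?thesis unfolding H_def K_def Z2_def N_def by blast
qed

end

section \<open>Normal forms in the presented group\<close>

definition (in group) word_val :: "('g \<Rightarrow> 'a) \<Rightarrow> ('g \<times> bool) list \<Rightarrow> 'a" where
  "word_val m u = foldr (\<lambda>(x, e) g. (if e then m x else inv (m x)) \<otimes> g) u \<one>"

text \<open>The universal property of the free group: words are evaluated letter by letter.\<close>
lemma (in group) free_group_lift:
  fixes m :: "'g \<Rightarrow> 'a"
  assumes m: "\<And>x. m x \<in> carrier G"
  obtains h where "h \<in> hom free_group G" and "\<And>x. h (free_gen x) = m x"
proof -
  have closed: "word_val m u \<in> carrier G" for u
    by (induction u) (auto simp: word_val_def m)
  have val_Cons: "word_val m ((x, e) # u) = (if e then m x else inv (m x)) \<otimes> word_val m u" for x e u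
    by (simp add: word_val_def)
  have app: "word_val m (u @ v) = word_val m u \<otimes> word_val m v" for u v
  proof (induction u)
    case Nil
    show ?case using closed by (simp add: word_val_def[of m "[]"])
  next
    case (Cons a u)
    then show ?case using closed m by (cases a) (simp add: val_Cons m_assoc)
  qed
  have eq: "word_val m u = word_val m v" if "word_eq u v" for u v
    using that
  proof induction
    case (cancel u x e v)
    have "word_val m [(x, e), (x, \<not> e)] = \<one>"
      using m by (simp add: word_val_def)
    then show ?case using closed unfolding app by simp
  qed simp_all
  define h where "h A = (THE g. \<exists>u. A = word_class u \<and> g = word_val m u)" for A
  have h: "h (word_class u) = word_val m u" for u
    unfolding h_def
  proof (rule the_equality)
    show "\<exists>v. word_class u = word_class v \<and> word_val m u = word_val m v" by blast
    show "g = word_val m u" if "\<exists>v. word_class u = word_class v \<and> g = word_val m v" for g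
      using that eq unfolding word_class_eq_iff by metis
  qed
  show ?thesis
  proof (rule that)
    show "h \<in> hom free_group G"
      by (rule homI) (auto simp: carrier_free_group mult_free_group h closed app)
    show "h (free_gen x) = m x" for x
      using m by (simp add: free_gen_def h word_val_def)
  qed
qed

text \<open>
  Von Dyck's theorem in the form in which it separates elements: a homomorphism that kills the relators
  is constant on the cosets of their normal closure.
\<close>
lemma presented_hom_eq:
  fixes R :: "('g \<times> bool) list set set"
  assumes M: "group M" and h: "h \<in> hom free_group M" and R: "R \<subseteq> carrier free_group"
    and triv: "\<And>\<rho>. \<rho> \<in> R \<Longrightarrow> h \<rho> = \<one>\<^bsub>M\<^esub>"
    and f: "f \<in> carrier free_group" "f' \<in> carrier free_group"
    and eq: "normal_closure free_group R #>\<^bsub>free_group\<^esub> f = normal_closure free_group R #>\<^bsub>free_group\<^esub> f'"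
  shows "h f = h f'"
proof -
  interpret F: group "free_group :: ('g \<times> bool) list set monoid" by (rule group_free_group)
  interpret M: group M by fact
  interpret h: group_hom free_group M h using h by unfold_locales
  interpret N: normal "normal_closure free_group R" free_group
    by (rule F.normal_closure_normal[OF R])
  have "R \<subseteq> kernel free_group M h" using R triv by (auto simp: kernel_def)
  then have N: "normal_closure free_group R \<subseteq> kernel free_group M h"
    using h.normal_kernel by (auto simp: normal_closure_def)
  have "f \<in> normal_closure free_group R #>\<^bsub>free_group\<^esub> f'"
    using F.rcos_self[OF f(1) N.subgroup_axioms] eq by simp
  then obtain n where n: "n \<in> normal_closure free_group R" "f = n \<otimes>\<^bsub>free_group\<^esub> f'"
    by (auto simp: r_coset_def)
  then have "n \<in> carrier free_group" "h n = \<one>\<^bsub>M\<^esub>" using N by (auto simp: kernel_def)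
  then show ?thesis using n(2) f(2) by simp
qed

context group
begin

lemma int_pow_cong:
  assumes g: "g \<in> carrier G" and n: "g [^] n = \<one>" and xy: "[x = y] (mod int n)"
  shows "g [^] (x::int) = g [^] y"
proof -
  obtain k where "x = y + int n * k"
    using cong_sym[OF xy] unfolding cong_iff_lin by blast
  then have "g [^] x = g [^] y \<otimes> (g [^] int n) [^] k"
    using g by (simp add: int_pow_mult int_pow_pow)
  then show ?thesis using g n by (simp add: int_pow_int)
qed

lemma commutator_eq_one:
  assumes "x \<in> carrier G" "y \<in> carrier G" "x \<otimes> y = y \<otimes> x"
  shows "inv x \<otimes> inv y \<otimes> x \<otimes> y = \<one>"
proof -
  have "inv x \<otimes> inv y \<otimes> x \<otimes> y = inv (y \<otimes> x) \<otimes> (x \<otimes> y)"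
    using assms(1,2) by (simp add: inv_mult_group m_assoc)
  then show ?thesis using assms by simp
qed

lemma conjugation_relator_eq_one:
  assumes "x \<in> carrier G" "y \<in> carrier G" "z \<in> carrier G" "y \<otimes> x = x \<otimes> z"
  shows "(inv x \<otimes> y \<otimes> x) \<otimes> inv z = \<one>"
proof -
  have "(inv x \<otimes> y \<otimes> x) \<otimes> inv z = (inv x \<otimes> (x \<otimes> z)) \<otimes> inv z"
    using assms by (simp add: m_assoc flip: assms(4))
  also have "inv x \<otimes> (x \<otimes> z) = z"
    using assms by (simp flip: m_assoc)
  finally show ?thesis using assms by simp
qed

text \<open>
  The relations of the group are given as \<open>A\<^sup>-\<^sup>1 X A = X\<^sup>t\<close>; moving \<open>A\<close> to the right of a power of \<open>X\<close>
  needs the inverse exponent \<open>t'\<close>.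
\<close>
lemma conjugate_int_pow:
  assumes A: "A \<in> carrier G" and X: "X \<in> carrier G" and n: "X [^] n = \<one>"
    and c: "inv A \<otimes> X \<otimes> A = X [^] (t::int)" and tt: "[t * t' = 1] (mod int n)"
  shows "A \<otimes> X [^] z = X [^] (t' * z) \<otimes> A"
proof -
  have pw: "inv A \<otimes> X [^] x \<otimes> A = X [^] (t * x)" for x :: int
  proof -
    have "(inv A \<otimes> X [^] (1::int) \<otimes> A) [^] x = inv A \<otimes> X [^] x \<otimes> A"
    proof (rule int_pow_eq_of_add_mult[where f = "\<lambda>x. inv A \<otimes> X [^] x \<otimes> A"])
      fix x y :: int
      have "(inv A \<otimes> X [^] x \<otimes> A) \<otimes> (inv A \<otimes> X [^] y \<otimes> A) =
          inv A \<otimes> X [^] x \<otimes> (A \<otimes> inv A) \<otimes> X [^] y \<otimes> A"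
        using A X by (simp only: m_assoc m_closed inv_closed int_pow_closed)
      also have "\<dots> = inv A \<otimes> X [^] (x + y) \<otimes> A"
        using A X by (simp add: int_pow_mult m_assoc)
      finally show "inv A \<otimes> X [^] (x + y) \<otimes> A = (inv A \<otimes> X [^] x \<otimes> A) \<otimes> (inv A \<otimes> X [^] y \<otimes> A)"
        by (rule HOL.sym)
    qed (use A X in simp)
    then show ?thesis using A X c by (simp add: int_pow_pow)
  qed
  have "[t * (t' * z) = z] (mod int n)"
    using cong_mult[OF tt cong_refl[of z]] by (simp add: mult.assoc)
  then have "inv A \<otimes> X [^] (t' * z) \<otimes> A = X [^] z"
    unfolding pw by (rule int_pow_cong[OF X n])
  then have "A \<otimes> X [^] z = A \<otimes> (inv A \<otimes> (X [^] (t' * z) \<otimes> A))"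
    using A X by (simp add: m_assoc)
  also have "\<dots> = X [^] (t' * z) \<otimes> A"
    using A X by (simp flip: m_assoc)
  finally show ?thesis .
qed

text \<open>
  The function \<open>v\<close> interpolates the powers of \<open>v 1\<close>. As \<open>A\<close> has finite order, negative exponents
  reduce to nonnegative ones.
\<close>
lemma int_pow_conjugate_int_pow:
  assumes A: "A \<in> carrier G" and X: "X \<in> carrier G" and n: "X [^] n = \<one>"
    and m: "A [^] (m::nat) = \<one>" "m > 0"
    and v_add: "\<And>i j. [v (i + j) = v i * v j] (mod int n)"
    and v_cong: "\<And>i j. [i = j] (mod int m) \<Longrightarrow> [v i = v j] (mod int n)"
    and v_0: "[v 0 = 1] (mod int n)"
    and step: "\<And>z. A \<otimes> X [^] z = X [^] (v 1 * z) \<otimes> A"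
  shows "A [^] (i::int) \<otimes> X [^] z = X [^] (v i * z) \<otimes> A [^] i"
proof -
  have nat: "A [^] k \<otimes> X [^] z = X [^] (v (int k) * z) \<otimes> A [^] k" for k z
  proof (induction k arbitrary: z)
    case 0
    have "X [^] (v 0 * z) = X [^] z"
      using cong_mult[OF v_0 cong_refl[of z]] by (intro int_pow_cong[OF X n]) simp
    then show ?case using X by simp
  next
    case (Suc k)
    have "A [^] Suc k \<otimes> X [^] z = A [^] k \<otimes> (A \<otimes> X [^] z)"
      using A X by (simp add: m_assoc)
    also have "\<dots> = (A [^] k \<otimes> X [^] (v 1 * z)) \<otimes> A"
      using A X by (simp add: step m_assoc)
    also have "\<dots> = X [^] (v (int k) * (v 1 * z)) \<otimes> A [^] Suc k"
      unfolding Suc.IH using A X by (simp add: m_assoc)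
    also have "X [^] (v (int k) * (v 1 * z)) = X [^] (v (int k + 1) * z)"
      using cong_mult[OF v_add[of "int k" 1] cong_refl[of z]]
      by (intro int_pow_cong[OF X n]) (simp add: mult.assoc cong_sym)
    finally show ?case by (simp add: add.commute)
  qed
  define k where "k = nat (i mod int m)"
  have k: "[i = int k] (mod int m)" using m(2) by (simp add: k_def cong_def)
  have "A [^] i = A [^] k" using int_pow_cong[OF A m(1) k] by (simp add: int_pow_int)
  moreover have "X [^] (v i * z) = X [^] (v (int k) * z)"
    by (intro int_pow_cong[OF X n] cong_mult v_cong[OF k] cong_refl)
  ultimately show ?thesis using nat by simp
qed

end

context power_character
begin

text \<open>
  A concrete group of reduced triples in which the relations hold, so that distinct normal forms in the
  presented group have distinct images. It is itself a coordinate group, which makes the power formulas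
  of that locale available for checking the relators.
\<close>
definition model_el :: "int \<Rightarrow> int \<Rightarrow> int \<Rightarrow> int \<times> int \<times> int" where
  "model_el x y i = (x mod int p, y mod int p, i mod int q ^ 2)"

definition model :: "(int \<times> int \<times> int) monoid" where
  "model =
    \<lparr>carrier = {model_el x y i | x y i. True},
     monoid.mult = \<lambda>(x, y, i) (x', y', i'). model_el (x + w i * x') (y + w (- i) * y') (i + i'),
     one = model_el 0 0 0\<rparr>"

lemma model_el_eq_iff: "model_el x y i = model_el x' y' i' \<longleftrightarrow>
    x \<approx> x' \<and> y \<approx> y' \<and> [i = i'] (mod int q ^ 2)"
  by (simp add: model_el_def cong_def)

lemma model_mult:
  "model_el x y i \<otimes>\<^bsub>model\<^esub> model_el x' y' i' = model_el (x + w i * x') (y + w (- i) * y') (i + i')"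
proof -
  have i: "[i mod int q ^ 2 = i] (mod int q ^ 2)" by simp
  then have i': "[- (i mod int q ^ 2) = - i] (mod int q ^ 2)" by (simp only: cong_minus_minus_iff)
  have *: "x mod int p + w j * (x' mod int p) \<approx> x + w i * x'" if "[j = i] (mod int q ^ 2)" for x x' i j
    using w_cong[OF that] by (intro cong_add cong_mult) simp_all
  have "model_el (x mod int p + w (i mod int q ^ 2) * (x' mod int p))
      (y mod int p + w (- (i mod int q ^ 2)) * (y' mod int p)) (i mod int q ^ 2 + i' mod int q ^ 2) =
      model_el (x + w i * x') (y + w (- i) * y') (i + i')"
    unfolding model_el_eq_iff using *[OF i] *[OF i'] by (auto simp: cong_def mod_simps)
  then show ?thesis by (simp add: model_def model_el_def)
qed

lemma group_model: "group model"
proof (rule groupI)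
  fix a b c assume "a \<in> carrier model" "b \<in> carrier model" "c \<in> carrier model"
  then obtain x y i x' y' i' x'' y'' i''
    where abc: "a = model_el x y i" "b = model_el x' y' i'" "c = model_el x'' y'' i''"
    by (auto simp: model_def)
  have *: "x + u * x' + w (i + i') * x'' \<approx> x + u * (x' + w i' * x'')" if "u = w i" for x x' x'' i i' u
  proof -
    have "x + u * x' + w (i + i') * x'' \<approx> x + u * x' + (w i * w i') * x''"
      by (intro cong_add cong_mult w_add cong_refl)
    then show ?thesis by (simp add: that algebra_simps)
  qed
  show "a \<otimes>\<^bsub>model\<^esub> b \<otimes>\<^bsub>model\<^esub> c = a \<otimes>\<^bsub>model\<^esub> (b \<otimes>\<^bsub>model\<^esub> c)"
    using *[of _ i x x' i' x''] *[of _ "-i" y y' "-i'" y'']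
    by (simp add: abc model_mult model_el_eq_iff algebra_simps)
next
  fix a assume "a \<in> carrier model"
  then obtain x y i where a: "a = model_el x y i" by (auto simp: model_def)
  have "model_el (- w (- i) * x) (- w i * y) (- i) \<otimes>\<^bsub>model\<^esub> a = \<one>\<^bsub>model\<^esub>"
    unfolding a model_mult by (simp add: model_def)
  moreover have "model_el (- w (- i) * x) (- w i * y) (- i) \<in> carrier model"
    by (auto simp: model_def)
  ultimately show "\<exists>b\<in>carrier model. b \<otimes>\<^bsub>model\<^esub> a = \<one>\<^bsub>model\<^esub>" by blast
  show "\<one>\<^bsub>model\<^esub> \<otimes>\<^bsub>model\<^esub> a = a"
    using w_0_mult[of x] w_0_mult[of y] model_mult[of 0 0 0 x y i]
    by (simp add: model_def[THEN arg_cong[where f = one]] a model_el_eq_iff)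
next
  fix a b assume "a \<in> carrier model" "b \<in> carrier model"
  then obtain x y i x' y' i' where ab: "a = model_el x y i" "b = model_el x' y' i'"
    by (auto simp: model_def)
  show "a \<otimes>\<^bsub>model\<^esub> b \<in> carrier model"
    unfolding ab model_mult by (auto simp: model_def)
qed (auto simp: model_def)

sublocale model: coordinate_group model p q w model_el
proof (intro coordinate_group.intro coordinate_group_axioms.intro group_model power_character_axioms)
  show "carrier model = {model_el x y i |x y i. True}" by (simp add: model_def)
qed (fact model_el_eq_iff model_mult)+

text \<open>
  Existence of the normal form follows from the multiplication rule, since the normal forms contain the
  generators and their inverses; uniqueness is tested in the model.
\<close>
lemma presented_group_coordinates:
  fixes r s :: int
  assumes s: "s \<approx> w 1" and rs: "r * s \<approx> 1"
  obtains el where "coordinate_group (group_G p q r s) p q w el"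
proof -
  let ?F = "free_group :: (gen \<times> bool) list set monoid"
  let ?R = "relators_G p q r s"
  let ?N = "normal_closure ?F ?R"
  let ?a = "free_gen GenA" and ?b = "free_gen GenB" and ?c = "free_gen GenC"
  define G where "G = group_G p q r s"
  interpret F: group ?F by (rule group_free_group)
  interpret G: group G unfolding G_def by (rule group_group_G)
  interpret N: normal ?N ?F by (rule F.normal_closure_normal[OF relators_G_subset])
  define \<pi> where "\<pi> x = ?N #>\<^bsub>?F\<^esub> x" for x
  have \<pi>_hom: "\<pi> \<in> hom ?F G"
    unfolding \<pi>_def[abs_def] G_def group_G_def presented_group_def by (rule N.r_coset_hom_Mod)
  interpret \<pi>: group_hom ?F G \<pi> using \<pi>_hom by unfold_locales
  have gens [simp]: "free_gen x \<in> carrier ?F" for x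
    by (simp add: free_gen_def carrier_free_group)
  have \<pi>_R: "\<pi> \<rho> = \<one>\<^bsub>G\<^esub>" if "\<rho> \<in> ?R" for \<rho>
  proof -
    have "\<rho> \<in> ?N" using that by (auto simp: normal_closure_def)
    then have "\<pi> \<rho> = ?N"
      unfolding \<pi>_def using N.subgroup_axioms N.subset by (intro F.coset_join2) auto
    then show ?thesis by (simp add: G_def group_G_def presented_group_def FactGroup_def)
  qed
  define A where "A = \<pi> ?a"
  define B where "B = \<pi> ?b"
  define C where "C = \<pi> ?c"
  have ABC [simp]: "A \<in> carrier G" "B \<in> carrier G" "C \<in> carrier G"
    by (simp_all add: A_def B_def C_def)
  have A_pow: "A [^]\<^bsub>G\<^esub> (q ^ 2) = \<one>\<^bsub>G\<^esub>" and B_pow: "B [^]\<^bsub>G\<^esub> p = \<one>\<^bsub>G\<^esub>" and C_pow: "C [^]\<^bsub>G\<^esub> p = \<one>\<^bsub>G\<^esub>"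
    using \<pi>_R[of "?a [^]\<^bsub>?F\<^esub> (q ^ 2)"] \<pi>_R[of "?b [^]\<^bsub>?F\<^esub> p"] \<pi>_R[of "?c [^]\<^bsub>?F\<^esub> p"]
    by (simp_all add: relators_G_def Let_def A_def B_def C_def \<pi>.hom_nat_pow)
  have "inv\<^bsub>G\<^esub> B \<otimes>\<^bsub>G\<^esub> inv\<^bsub>G\<^esub> C \<otimes>\<^bsub>G\<^esub> B \<otimes>\<^bsub>G\<^esub> C = \<one>\<^bsub>G\<^esub>"
    using \<pi>_R[of "inv\<^bsub>?F\<^esub> ?b \<otimes>\<^bsub>?F\<^esub> inv\<^bsub>?F\<^esub> ?c \<otimes>\<^bsub>?F\<^esub> ?b \<otimes>\<^bsub>?F\<^esub> ?c"]
    by (simp add: relators_G_def Let_def B_def C_def)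
  then have "inv\<^bsub>G\<^esub> C \<otimes>\<^bsub>G\<^esub> B \<otimes>\<^bsub>G\<^esub> C = B"
    using G.inv_solve_left[of "\<one>\<^bsub>G\<^esub>" B "inv\<^bsub>G\<^esub> C \<otimes>\<^bsub>G\<^esub> B \<otimes>\<^bsub>G\<^esub> C"] by (simp add: G.m_assoc)
  then have CB: "inv\<^bsub>G\<^esub> C \<otimes>\<^bsub>G\<^esub> B \<otimes>\<^bsub>G\<^esub> C = B [^]\<^bsub>G\<^esub> (1::int)" by simp
  have "inv\<^bsub>G\<^esub> A \<otimes>\<^bsub>G\<^esub> B \<otimes>\<^bsub>G\<^esub> A \<otimes>\<^bsub>G\<^esub> inv\<^bsub>G\<^esub> (B [^]\<^bsub>G\<^esub> r) = \<one>\<^bsub>G\<^esub>"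
    using \<pi>_R[of "(inv\<^bsub>?F\<^esub> ?a \<otimes>\<^bsub>?F\<^esub> ?b \<otimes>\<^bsub>?F\<^esub> ?a) \<otimes>\<^bsub>?F\<^esub> inv\<^bsub>?F\<^esub> (?b [^]\<^bsub>?F\<^esub> r)"]
    by (simp add: relators_G_def Let_def A_def B_def \<pi>.hom_int_pow)
  then have "inv\<^bsub>G\<^esub> (inv\<^bsub>G\<^esub> (B [^]\<^bsub>G\<^esub> r)) = inv\<^bsub>G\<^esub> A \<otimes>\<^bsub>G\<^esub> B \<otimes>\<^bsub>G\<^esub> A"
    by (rule G.inv_equality) simp_all
  then have BA: "inv\<^bsub>G\<^esub> A \<otimes>\<^bsub>G\<^esub> B \<otimes>\<^bsub>G\<^esub> A = B [^]\<^bsub>G\<^esub> r" by simp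
  have "inv\<^bsub>G\<^esub> A \<otimes>\<^bsub>G\<^esub> C \<otimes>\<^bsub>G\<^esub> A \<otimes>\<^bsub>G\<^esub> inv\<^bsub>G\<^esub> (C [^]\<^bsub>G\<^esub> s) = \<one>\<^bsub>G\<^esub>"
    using \<pi>_R[of "(inv\<^bsub>?F\<^esub> ?a \<otimes>\<^bsub>?F\<^esub> ?c \<otimes>\<^bsub>?F\<^esub> ?a) \<otimes>\<^bsub>?F\<^esub> inv\<^bsub>?F\<^esub> (?c [^]\<^bsub>?F\<^esub> s)"]
    by (simp add: relators_G_def Let_def A_def C_def \<pi>.hom_int_pow)
  then have "inv\<^bsub>G\<^esub> (inv\<^bsub>G\<^esub> (C [^]\<^bsub>G\<^esub> s)) = inv\<^bsub>G\<^esub> A \<otimes>\<^bsub>G\<^esub> C \<otimes>\<^bsub>G\<^esub> A"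
    by (rule G.inv_equality) simp_all
  then have CA: "inv\<^bsub>G\<^esub> A \<otimes>\<^bsub>G\<^esub> C \<otimes>\<^bsub>G\<^esub> A = C [^]\<^bsub>G\<^esub> s" by simp
  have comm: "C [^]\<^bsub>G\<^esub> y \<otimes>\<^bsub>G\<^esub> B [^]\<^bsub>G\<^esub> x = B [^]\<^bsub>G\<^esub> x \<otimes>\<^bsub>G\<^esub> C [^]\<^bsub>G\<^esub> y" for x y :: int
  proof -
    have "C \<otimes>\<^bsub>G\<^esub> B [^]\<^bsub>G\<^esub> x = B [^]\<^bsub>G\<^esub> x \<otimes>\<^bsub>G\<^esub> C"
      using G.conjugate_int_pow[OF _ _ B_pow CB, of 1 x] by simp
    then have "inv\<^bsub>G\<^esub> (B [^]\<^bsub>G\<^esub> x) \<otimes>\<^bsub>G\<^esub> C \<otimes>\<^bsub>G\<^esub> B [^]\<^bsub>G\<^esub> x = C [^]\<^bsub>G\<^esub> (1::int)"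
      by (simp add: G.m_assoc) (simp flip: G.m_assoc)
    from G.conjugate_int_pow[OF _ _ C_pow this, of 1 y] show ?thesis by simp
  qed
  have w_s: "s * w (- 1) \<approx> 1"
    using cong_mult[OF s cong_refl[of "w (- 1)"]] w_add[of 1 "- 1"] w_0
    by (simp add: cong_def)
  have w_r: "r * w 1 \<approx> 1"
    using cong_mult[OF cong_refl[of r] s] rs by (simp add: cong_def)
  have q2: "q ^ 2 > 0" using prime_gt_0_nat[OF q] by simp
  have A_B: "A [^]\<^bsub>G\<^esub> i \<otimes>\<^bsub>G\<^esub> B [^]\<^bsub>G\<^esub> x = B [^]\<^bsub>G\<^esub> (w i * x) \<otimes>\<^bsub>G\<^esub> A [^]\<^bsub>G\<^esub> i" for i x :: int
    by (rule G.int_pow_conjugate_int_pow[OF _ _ B_pow A_pow q2, where v = w])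
      (use w_add w_0 w_cong G.conjugate_int_pow[OF _ _ B_pow BA w_r] in simp_all)
  have A_C: "A [^]\<^bsub>G\<^esub> i \<otimes>\<^bsub>G\<^esub> C [^]\<^bsub>G\<^esub> y = C [^]\<^bsub>G\<^esub> (w (- i) * y) \<otimes>\<^bsub>G\<^esub> A [^]\<^bsub>G\<^esub> i" for i y :: int
  proof (rule G.int_pow_conjugate_int_pow[OF _ _ C_pow A_pow q2, where v = "\<lambda>i. w (- i)"])
    show "w (- (i + j)) \<approx> w (- i) * w (- j)" for i j
      using w_add[of "- i" "- j"] by simp
    show "w (- i) \<approx> w (- j)" if "[i = j] (mod int (q ^ 2))" for i j
      using that by (intro w_cong) (simp add: cong_minus_minus_iff)
  qed (use w_0 G.conjugate_int_pow[OF _ _ C_pow CA w_s] in simp_all)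
  define el where "el x y i = B [^]\<^bsub>G\<^esub> x \<otimes>\<^bsub>G\<^esub> C [^]\<^bsub>G\<^esub> y \<otimes>\<^bsub>G\<^esub> A [^]\<^bsub>G\<^esub> i" for x y i :: int
  have el_closed: "el x y i \<in> carrier G" for x y i by (simp add: el_def)
  have el_mult: "el x y i \<otimes>\<^bsub>G\<^esub> el x' y' i' = el (x + w i * x') (y + w (- i) * y') (i + i')" for x y i x' y' i'
  proof -
    have "el x y i \<otimes>\<^bsub>G\<^esub> el x' y' i' = B [^]\<^bsub>G\<^esub> x \<otimes>\<^bsub>G\<^esub> C [^]\<^bsub>G\<^esub> y \<otimes>\<^bsub>G\<^esub>
        (A [^]\<^bsub>G\<^esub> i \<otimes>\<^bsub>G\<^esub> B [^]\<^bsub>G\<^esub> x') \<otimes>\<^bsub>G\<^esub> C [^]\<^bsub>G\<^esub> y' \<otimes>\<^bsub>G\<^esub> A [^]\<^bsub>G\<^esub> i'"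
      by (simp add: el_def G.m_assoc)
    also have "\<dots> = B [^]\<^bsub>G\<^esub> x \<otimes>\<^bsub>G\<^esub> (C [^]\<^bsub>G\<^esub> y \<otimes>\<^bsub>G\<^esub> B [^]\<^bsub>G\<^esub> (w i * x')) \<otimes>\<^bsub>G\<^esub>
        (A [^]\<^bsub>G\<^esub> i \<otimes>\<^bsub>G\<^esub> C [^]\<^bsub>G\<^esub> y') \<otimes>\<^bsub>G\<^esub> A [^]\<^bsub>G\<^esub> i'"
      unfolding A_B by (simp add: G.m_assoc)
    also have "\<dots> = (B [^]\<^bsub>G\<^esub> x \<otimes>\<^bsub>G\<^esub> B [^]\<^bsub>G\<^esub> (w i * x')) \<otimes>\<^bsub>G\<^esub>
        (C [^]\<^bsub>G\<^esub> y \<otimes>\<^bsub>G\<^esub> C [^]\<^bsub>G\<^esub> (w (- i) * y')) \<otimes>\<^bsub>G\<^esub> (A [^]\<^bsub>G\<^esub> i \<otimes>\<^bsub>G\<^esub> A [^]\<^bsub>G\<^esub> i')"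
      unfolding A_C comm by (simp add: G.m_assoc)
    finally show ?thesis by (simp add: el_def G.int_pow_mult)
  qed
  have "coordinate_group G p q w el"
  proof (intro coordinate_group.intro coordinate_group_axioms.intro G.group_axioms power_character_axioms el_mult)
    have gen_el: "\<exists>x y i. \<pi> (free_gen g) = el x y i" for g
    proof (cases g)
      case GenA
      then have "\<pi> (free_gen g) = el 0 0 1" by (simp add: el_def A_def)
      then show ?thesis by blast
    next
      case GenB
      then have "\<pi> (free_gen g) = el 1 0 0" by (simp add: el_def B_def)
      then show ?thesis by blast
    next
      case GenC
      then have "\<pi> (free_gen g) = el 0 1 0" by (simp add: el_def C_def)
      then show ?thesis by blast
    qed
    have inv_gen_el: "\<exists>x y i. \<pi> (inv\<^bsub>?F\<^esub> (free_gen g)) = el x y i" for g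
    proof (cases g)
      case GenA
      then have "\<pi> (inv\<^bsub>?F\<^esub> (free_gen g)) = el 0 0 (- 1)" by (simp add: el_def A_def G.int_pow_neg)
      then show ?thesis by blast
    next
      case GenB
      then have "\<pi> (inv\<^bsub>?F\<^esub> (free_gen g)) = el (- 1) 0 0" by (simp add: el_def B_def G.int_pow_neg)
      then show ?thesis by blast
    next
      case GenC
      then have "\<pi> (inv\<^bsub>?F\<^esub> (free_gen g)) = el 0 (- 1) 0" by (simp add: el_def C_def G.int_pow_neg)
      then show ?thesis by blast
    qed
    have word: "\<exists>x y i. \<pi> (word_class u) = el x y i" for u
    proof (induction u)
      case Nil
      have "\<pi> (word_class []) = el 0 0 0" using \<pi>.hom_one by (simp add: el_def one_free_group)
      then show ?case by blast
    next
      case (Cons a u)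
      obtain g e where a: "a = (g, e)" by force
      have "inv\<^bsub>?F\<^esub> (free_gen g) = word_class [(g, False)]"
        using word_eq.cancel[of "[]" g False "[]"]
        by (intro F.inv_equality)
          (simp_all add: free_gen_def mult_free_group one_free_group carrier_free_group word_class_eq_iff rangeI)
      then have "word_class [(g, e)] = (if e then free_gen g else inv\<^bsub>?F\<^esub> (free_gen g))"
        by (simp add: free_gen_def)
      then obtain x y i where "\<pi> (word_class [(g, e)]) = el x y i"
        using gen_el[of g] inv_gen_el[of g] by (cases e) (auto simp del: \<pi>.hom_inv)
      moreover obtain x' y' i' where "\<pi> (word_class u) = el x' y' i'" using Cons.IH by blast
      moreover have "\<pi> (word_class (a # u)) = \<pi> (word_class [(g, e)]) \<otimes>\<^bsub>G\<^esub> \<pi> (word_class u)"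
        using \<pi>.hom_mult[of "word_class [(g, e)]" "word_class u"]
        by (simp add: a mult_free_group carrier_free_group)
      ultimately show ?case using el_mult by metis
    qed
    have "carrier G = \<pi> ` carrier ?F"
      by (auto simp: G_def group_G_def presented_group_def FactGroup_def RCOSETS_def \<pi>_def)
    then show "carrier G = {el x y i |x y i. True}"
      using word el_closed by (fastforce simp: carrier_free_group)
  next
    fix x y i x' y' i'
    define m where "m g = (case g of GenA \<Rightarrow> model_el 0 0 1 | GenB \<Rightarrow> model_el 1 0 0 | GenC \<Rightarrow> model_el 0 1 0)" for g
    have "m g \<in> carrier model" for g by (simp add: m_def split: gen.split)
    then obtain h where h: "h \<in> hom ?F model" and "\<And>g. h (free_gen g) = m g"
      using model.free_group_lift by blast
    then have hg: "h ?a = model_el 0 0 1" "h ?b = model_el 1 0 0" "h ?c = model_el 0 1 0"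
      by (simp_all add: m_def)
    interpret h: group_hom ?F model h using h by unfold_locales
    have triv: "h \<rho> = \<one>\<^bsub>model\<^esub>" if "\<rho> \<in> ?R" for \<rho>
    proof -
      have "h (?a [^]\<^bsub>?F\<^esub> (q ^ 2)) = \<one>\<^bsub>model\<^esub>"
        using model.el_top_pow[of "int (q ^ 2)"]
        by (simp add: h.hom_nat_pow hg int_pow_int model.el_eq_one_iff cong_0_iff flip: of_nat_power)
      moreover have "h (?b [^]\<^bsub>?F\<^esub> p) = \<one>\<^bsub>model\<^esub>" "h (?c [^]\<^bsub>?F\<^esub> p) = \<one>\<^bsub>model\<^esub>"
        using model.el_kernel_pow[of _ _ "int p"]
        by (simp_all add: h.hom_nat_pow hg int_pow_int model.el_eq_one_iff cong_0_iff)
      moreover have "h (inv\<^bsub>?F\<^esub> ?b \<otimes>\<^bsub>?F\<^esub> inv\<^bsub>?F\<^esub> ?c \<otimes>\<^bsub>?F\<^esub> ?b \<otimes>\<^bsub>?F\<^esub> ?c) = \<one>\<^bsub>model\<^esub>"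
        using w_0_mult[of 1] model.commutator_eq_one[of "model_el 1 0 0" "model_el 0 1 0"]
        by (simp add: hg model_mult model_el_eq_iff cong_sym)
      moreover have "h ((inv\<^bsub>?F\<^esub> ?a \<otimes>\<^bsub>?F\<^esub> ?b \<otimes>\<^bsub>?F\<^esub> ?a) \<otimes>\<^bsub>?F\<^esub> inv\<^bsub>?F\<^esub> (?b [^]\<^bsub>?F\<^esub> r)) = \<one>\<^bsub>model\<^esub>"
        using w_r model.conjugation_relator_eq_one[of "model_el 0 0 1" "model_el 1 0 0" "model_el r 0 0"]
        by (simp add: hg h.hom_int_pow model.el_kernel_pow model_mult model_el_eq_iff cong_sym mult.commute)
      moreover have "h ((inv\<^bsub>?F\<^esub> ?a \<otimes>\<^bsub>?F\<^esub> ?c \<otimes>\<^bsub>?F\<^esub> ?a) \<otimes>\<^bsub>?F\<^esub> inv\<^bsub>?F\<^esub> (?c [^]\<^bsub>?F\<^esub> s)) = \<one>\<^bsub>model\<^esub>"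
        using w_s model.conjugation_relator_eq_one[of "model_el 0 0 1" "model_el 0 1 0" "model_el 0 s 0"]
        by (simp add: hg h.hom_int_pow model.el_kernel_pow model_mult model_el_eq_iff cong_sym mult.commute)
      ultimately show ?thesis using that unfolding relators_G_def Let_def by blast
    qed
    define f where "f x y i = ?b [^]\<^bsub>?F\<^esub> x \<otimes>\<^bsub>?F\<^esub> ?c [^]\<^bsub>?F\<^esub> y \<otimes>\<^bsub>?F\<^esub> ?a [^]\<^bsub>?F\<^esub> i" for x y i :: int
    have f_closed: "f x y i \<in> carrier ?F" for x y i by (simp add: f_def)
    have \<pi>f: "\<pi> (f x y i) = el x y i" for x y i
      by (simp add: f_def el_def \<pi>.hom_int_pow A_def B_def C_def)
    have hf: "h (f x y i) = model_el x y i" for x y i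
      by (simp add: f_def h.hom_int_pow hg flip: model.el_as_powers)
    show "el x y i = el x' y' i' \<longleftrightarrow> x \<approx> x' \<and> y \<approx> y' \<and> [i = i'] (mod int q ^ 2)"
    proof
      assume "el x y i = el x' y' i'"
      then have "h (f x y i) = h (f x' y' i')"
        unfolding \<pi>f[symmetric] \<pi>_def
        by (intro presented_hom_eq[OF group_model h relators_G_subset triv f_closed f_closed])
      then show "x \<approx> x' \<and> y \<approx> y' \<and> [i = i'] (mod int q ^ 2)"
        by (simp add: hf model_el_eq_iff)
    next
      assume "x \<approx> x' \<and> y \<approx> y' \<and> [i = i'] (mod int q ^ 2)"
      then show "el x y i = el x' y' i'"
        unfolding el_def using G.int_pow_cong[OF _ B_pow, of x x'] G.int_pow_cong[OF _ C_pow, of y y']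
          G.int_pow_cong[OF _ A_pow, of i i'] by simp
    qed
  qed
  then show ?thesis using that unfolding G_def by blast
qed

end

section \<open>The automorphism group of the presented group\<close>

theorem mainTheorem8:
  fixes p q :: nat and r s :: int
  assumes "prime p" and "prime q" and "p \<noteq> q"
    and "p * q \<noteq> 6" and "q \<noteq> 2" and "q dvd p - 1"
    and "[r ^ q = 1] (mod int p)" and "\<not> [r = 1] (mod int p)"
    and "[r * s = 1] (mod int p)"
  shows "\<exists>\<psi> \<phi>.
    \<psi> \<in> hom (integer_mod_group 2)
          (AutoGroup ((integer_mod_group (p - 1) \<times>\<times> integer_mod_group (p - 1)) \<times>\<times> integer_mod_group q)) \<and>
    \<phi> \<in> hom
          (semidirect_product
            ((integer_mod_group (p - 1) \<times>\<times> integer_mod_group (p - 1)) \<times>\<times> integer_mod_group q)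
            (integer_mod_group 2) \<psi>)
          (AutoGroup (integer_mod_group p \<times>\<times> integer_mod_group p)) \<and>
    AutoGroup (group_G p q r s) \<cong>
      semidirect_product (integer_mod_group p \<times>\<times> integer_mod_group p)
        (semidirect_product
          ((integer_mod_group (p - 1) \<times>\<times> integer_mod_group (p - 1)) \<times>\<times> integer_mod_group q)
          (integer_mod_group 2) \<psi>)
        \<phi>"
proof -
  \<comment> \<open>with \<open>s = e t\<close> the powers of \<open>s\<close> become \<open>e (t * i)\<close>, which makes sense for every integer \<open>i\<close>\<close>
  obtain e where e_add: "\<And>u v. [e (u + v) = e u * e v] (mod int p)"
    and e_cong_iff: "\<And>u v. [e u = e v] (mod int p) \<longleftrightarrow> [u = v] (mod int (p - 1))"
    and e_surj: "\<And>x. \<not> int p dvd x \<Longrightarrow> \<exists>u. [x = e u] (mod int p)"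
    and e_0: "e 0 = 1"
    using discrete_exponential_exists[OF assms(1)] by blast
  have p: "prime (int p)" using assms(1) by simp
  have "\<not> int p dvd s"
  proof
    assume "int p dvd s"
    then have "int p dvd 1" using assms(9) cong_dvd_iff dvd_mult by blast
    then show False using p not_prime_unit by blast
  qed
  then obtain t where t: "[s = e t] (mod int p)" using e_surj by blast
  have e_1_iff: "[e u = 1] (mod int p) \<longleftrightarrow> int (p - 1) dvd u" for u
    using e_cong_iff[of u 0] by (simp add: e_0 cong_0_iff)
  have e_nat: "[e (t * int n) = s ^ n] (mod int p)" for n
  proof (induction n)
    case (Suc n)
    have "[e (t + t * int n) = e t * e (t * int n)] (mod int p)" by (rule e_add)
    moreover have "[e t * e (t * int n) = s * s ^ n] (mod int p)"
      by (intro cong_mult Suc.IH cong_sym[OF t])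
    ultimately show ?case by (simp add: distrib_left cong_trans)
  qed (simp add: e_0)
  have "[r ^ q * s ^ q = 1] (mod int p)"
    using cong_pow[OF assms(9), of q] by (simp add: power_mult_distrib)
  then have "[s ^ q = 1] (mod int p)"
    using cong_mult[OF assms(7) cong_refl[of "s ^ q"]] by (simp add: cong_def)
  then have tq: "int (p - 1) dvd t * int q"
    using e_nat[of q] unfolding e_1_iff[symmetric] by (rule cong_trans[rotated])
  have t1: "\<not> int (p - 1) dvd t"
  proof
    assume "int (p - 1) dvd t"
    then have "[s = 1] (mod int p)" using t e_1_iff cong_trans by blast
    then have "[r * s = r] (mod int p)" using cong_mult[OF cong_refl[of r]] by fastforce
    then show False using assms(8,9) by (simp add: cong_def)
  qed
  interpret power_character p q "\<lambda>i. e (t * i)"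
  proof
    show "[e (t * (i + j)) = e (t * i) * e (t * j)] (mod int p)" for i j
      unfolding distrib_left by (rule e_add)
    show "[e (t * i) = 1] (mod int p) \<longleftrightarrow> int q dvd i" for i
    proof
      assume "int q dvd i"
      then have "t * int q dvd t * i" by simp
      then show "[e (t * i) = 1] (mod int p)" unfolding e_1_iff using tq dvd_trans by blast
    next
      assume "[e (t * i) = 1] (mod int p)"
      then have ti: "int (p - 1) dvd t * i" by (simp only: e_1_iff)
      show "int q dvd i"
      proof (rule ccontr)
        assume "\<not> int q dvd i"
        then have "coprime (int q) i" using assms(2) by (intro prime_imp_coprime) simp_all
        then obtain x y where "x * int q + y * i = 1"
          using bezout_int[of "int q" i] by (auto simp: coprime_iff_gcd_eq_1)
        then have "t = x * (t * int q) + y * (t * i)" by (metis distrib_left mult.left_commute mult.right_neutral)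
        then show False using t1 tq ti by (metis dvd_add dvd_mult)
      qed
    qed
  qed (use assms in auto)
  obtain el where "coordinate_group (group_G p q r s) p q (\<lambda>i. e (t * i)) el"
    by (rule presented_group_coordinates[of s r]) (use t assms(9) in simp_all)
  then interpret coordinate_group "group_G p q r s" p q "\<lambda>i. e (t * i)" el .
  show ?thesis by (rule aut_group_structure[OF e_add e_cong_iff e_surj e_0])
qed

end
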